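(* There exists no constant $C>0$ such that the lower bound $\log K(f_\varphi)\geq C\|\varphi\|_{cr}$ holds for every minimal Lagrangian extension $f_\varphi:\mathbb{H}^2\to\mathbb{H}^2$ of a quasisymmetric homeomorphism $\varphi:\mathbb{R}\mathrm{P}^1\to\mathbb{R}\mathrm{P}^1$.
   Context: $\mathbb{H}^2$ is the hyperbolic plane in the upper half-plane model $\{z=x+iy: y>0\}$ with metric $g_{\mathbb{H}^2}=(dx^2+dy^2)/y^2$; its boundary at infinity is $\mathbb{R}\mathrm{P}^1\cong\mathbb{R}\cup\{\infty\}$. Cross-ratio: $cr(x_1,x_2,x_3,x_4)=\frac{(x_4-x_1)(x_3-x_2)}{(x_2-x_1)(x_3-x_4)}$ for quadruples of points of $\mathbb{R}\mathrm{P}^1$ (extended to $\infty$ by continuity). For an orientation-preserving homeomorphism $\varphi$ of $\mathbb{R}\mathrm{P}^1$, the cross-ratio norm is $\|\varphi\|_{cr}=\sup_{cr(Q)=-1}|\log|cr(\varphi(Q))||$, the supremum being over quadruples $Q$ with $cr(Q)=-1$; $\varphi$ is quasisymmetric if $\|\varphi\|_{cr}<+\infty$. For an orientation-preserving diffeomorphism $f:\mathbb{H}^2\to\mathbb{H}^2$, its maximal dilatation is $K(f)=\sup_{z\in\mathbb{H}^2}\frac{\text{major axis of }df_z(\mathbb{S}^1)}{\text{minor axis of }df_z(\mathbb{S}^1)}$, where $\mathbb{S}^1$ is the unit circle in $T_z\mathbb{H}^2=\mathbb{C}$; $f$ is quasiconformal if $K(f)<+\infty$. An orientation-preserving diffeomorphism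 $f:\mathbb{H}^2\to\mathbb{H}^2$ is minimal Lagrangian if it is area-preserving and its graph is a minimal surface in the Riemannian product $\mathbb{H}^2\times\mathbb{H}^2$. Equivalently, $f^*g_{\mathbb{H}^2}=g_{\mathbb{H}^2}(b\cdot,b\cdot)$ for some section $b$ of $\mathrm{End}(T\mathbb{H}^2)$ which is self-adjoint for $g_{\mathbb{H}^2}$, has $\det b=1$ and satisfies $d^\nabla b=0$, where $(d^\nabla b)(v,w)=\nabla_v(b(w))-\nabla_w(b(v))-b[v,w]$ and $\nabla$ is the Levi-Civita connection of $g_{\mathbb{H}^2}$. By a theorem of Bonsante and Schlenker, every quasisymmetric homeomorphism $\varphi$ of $\mathbb{R}\mathrm{P}^1$ has a unique minimal Lagrangian diffeomorphism $f_\varphi:\mathbb{H}^2\to\mathbb{H}^2$ extending it continuously, and $f_\varphi$ is quasiconformal. *)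

theory Defs
  imports "HOL-Analysis.Analysis"
begin

section \<open>The circle at infinity and the closed disc\<close>

text \<open>
  The real projective line is the one-point compactification of the reals; \<^term>\<open>None\<close> is the
  point at infinity.
\<close>

definition RP1 :: "real option topology"
  where "RP1 = Alexandroff_compactification euclideanreal"

definition rp_ereal :: "real option \<Rightarrow> ereal"
  where "rp_ereal p = (case p of None \<Rightarrow> \<infinity> | Some x \<Rightarrow> ereal x)"

definition cyc_ordered :: "real option \<Rightarrow> real option \<Rightarrow> real option \<Rightarrow> bool"
  where "cyc_ordered p q r \<longleftrightarrow>
     rp_ereal p < rp_ereal q \<and> rp_ereal q < rp_ereal r \<or>
     rp_ereal q < rp_ereal r \<and> rp_ereal r < rp_ereal p \<or>
     rp_ereal r < rp_ereal p \<and> rp_ereal p < rp_ereal q"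

definition op_homeo_RP1 :: "(real option \<Rightarrow> real option) \<Rightarrow> bool"
  where "op_homeo_RP1 \<phi> \<longleftrightarrow>
     homeomorphic_map RP1 RP1 \<phi> \<and>
     (\<forall>p q r. cyc_ordered p q r \<longrightarrow> cyc_ordered (\<phi> p) (\<phi> q) (\<phi> r))"

text \<open>
  \<open>pdiff p q\<close> is the determinant of the homogeneous coordinate vectors of \<open>p\<close> and \<open>q\<close>, namely
  \<open>(x, 1)\<close> for \<open>Some x\<close> and \<open>(1, 0)\<close> for \<open>None\<close>.  Each point occurs once in the numerator and once
  in the denominator of the cross-ratio, so replacing differences by these determinants gives the
  continuous extension to infinity.  For instance \<open>x\<^sub>1 = None\<close> yields
  \<open>(x\<^sub>3 - x\<^sub>2) / (x\<^sub>3 - x\<^sub>4)\<close>.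
\<close>

fun pdiff :: "real option \<Rightarrow> real option \<Rightarrow> real" where
  "pdiff (Some x) (Some y) = x - y"
| "pdiff (Some x) None = - 1"
| "pdiff None (Some y) = 1"
| "pdiff None None = 0"

definition cross_ratio :: "real option \<Rightarrow> real option \<Rightarrow> real option \<Rightarrow> real option \<Rightarrow> real"
  where "cross_ratio x1 x2 x3 x4 =
     (pdiff x4 x1 * pdiff x3 x2) / (pdiff x2 x1 * pdiff x3 x4)"

text \<open>
  A quadruple with cross-ratio \<open>-1\<close> automatically consists of four distinct points: equality of two
  of them makes the value \<open>0\<close> (possibly through division by zero) or \<open>1\<close>.
\<close>

definition cr_norm :: "(real option \<Rightarrow> real option) \<Rightarrow> ereal"
  where "cr_norm \<phi> =
     (SUP (x1, x2, x3, x4) \<in> {(x1, x2, x3, x4). cross_ratio x1 x2 x3 x4 = - 1}.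
        ereal \<bar>ln \<bar>cross_ratio (\<phi> x1) (\<phi> x2) (\<phi> x3) (\<phi> x4)\<bar>\<bar>)"

definition quasisymmetric :: "(real option \<Rightarrow> real option) \<Rightarrow> bool"
  where "quasisymmetric \<phi> \<longleftrightarrow> op_homeo_RP1 \<phi> \<and> cr_norm \<phi> < \<infinity>"

definition half_plane :: "complex set"
  where "half_plane = {z. Im z > 0}"

definition closed_disc :: "complex option topology"
  where "closed_disc = Alexandroff_compactification (top_of_set {z. Im z \<ge> 0})"

definition glue_boundary ::
    "(complex \<Rightarrow> complex) \<Rightarrow> (real option \<Rightarrow> real option) \<Rightarrow> complex option \<Rightarrow> complex option"
  where "glue_boundary f \<phi> p =
     (case p of
        None \<Rightarrow> map_option complex_of_real (\<phi> None)
      | Some z \<Rightarrow> if z \<in> half_plane then Some (f z)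
                  else map_option complex_of_real (\<phi> (Some (Re z))))"

definition extends_continuously :: "(complex \<Rightarrow> complex) \<Rightarrow> (real option \<Rightarrow> real option) \<Rightarrow> bool"
  where "extends_continuously f \<phi> \<longleftrightarrow>
     continuous_map closed_disc closed_disc (glue_boundary f \<phi>)"


section \<open>Diffeomorphisms of the half-plane and their dilatation\<close>

abbreviation dff :: "(complex \<Rightarrow> complex) \<Rightarrow> complex \<Rightarrow> complex \<Rightarrow> complex"
  where "dff f z \<equiv> frechet_derivative f (at z)"

text \<open>The following two notions are meant for open sets \<open>S\<close> only.\<close>

fun Ck_on :: "nat \<Rightarrow> complex set \<Rightarrow> (complex \<Rightarrow> complex) \<Rightarrow> bool" where
  "Ck_on 0 S f \<longleftrightarrow> continuous_on S f"
| "Ck_on (Suc k) S f \<longleftrightarrow>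
     (\<forall>z\<in>S. f differentiable (at z)) \<and> (\<forall>v. Ck_on k S (\<lambda>z. dff f z v))"

definition smooth_on :: "complex set \<Rightarrow> (complex \<Rightarrow> complex) \<Rightarrow> bool"
  where "smooth_on S f \<longleftrightarrow> (\<forall>k. Ck_on k S f)"

definition oriented_area :: "complex \<Rightarrow> complex \<Rightarrow> real"
  where "oriented_area v w = Re v * Im w - Im v * Re w"

definition op_diffeo :: "(complex \<Rightarrow> complex) \<Rightarrow> bool"
  where "op_diffeo f \<longleftrightarrow>
     bij_betw f half_plane half_plane \<and>
     smooth_on half_plane f \<and> smooth_on half_plane (inv_into half_plane f) \<and>
     (\<forall>z\<in>half_plane. oriented_area (dff f z 1) (dff f z \<i>) > 0)"

text \<open>
  The axes of the ellipse \<open>df\<^sub>z(S\<^sup>1)\<close> have lengths twice the extreme values of \<open>|df\<^sub>z(v)|\<close> for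
  unit \<open>v\<close>.  As the metric is conformal, measuring them in the Euclidean norm does not change the
  ratio.
\<close>

definition dilatation_at :: "(complex \<Rightarrow> complex) \<Rightarrow> complex \<Rightarrow> real"
  where "dilatation_at f z =
     (SUP v\<in>sphere 0 1. norm (dff f z v)) / (INF v\<in>sphere 0 1. norm (dff f z v))"

definition max_dilatation :: "(complex \<Rightarrow> complex) \<Rightarrow> ereal"
  where "max_dilatation f = (SUP z\<in>half_plane. ereal (dilatation_at f z))"

definition log_ereal :: "ereal \<Rightarrow> ereal"
  where "log_ereal K = (if K = \<infinity> then \<infinity> else ereal (ln (real_of_ereal K)))"


section \<open>Minimal Lagrangian diffeomorphisms\<close>

definition hyp_inner :: "complex \<Rightarrow> complex \<Rightarrow> complex \<Rightarrow> real"
  where "hyp_inner z v w = (v \<bullet> w) / (Im z)\<^sup>2"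

text \<open>
  Christoffel symbols of the Levi-Civita connection of \<open>(dx\<^sup>2 + dy\<^sup>2) / y\<^sup>2\<close>, that is
  \<open>\<nabla>\<^sub>x \<partial>\<^sub>x = \<partial>\<^sub>y / y\<close>, \<open>\<nabla>\<^sub>x \<partial>\<^sub>y = \<nabla>\<^sub>y \<partial>\<^sub>x = - \<partial>\<^sub>x / y\<close> and \<open>\<nabla>\<^sub>y \<partial>\<^sub>y = - \<partial>\<^sub>y / y\<close>, written with
  complex multiplication.  The two lemmas below state that the connection is torsion-free and
  compatible with the metric.
\<close>

definition christoffel :: "complex \<Rightarrow> complex \<Rightarrow> complex \<Rightarrow> complex"
  where "christoffel z v w = \<i> * v * w / of_real (Im z)"

lemma christoffel_sym: "christoffel z v w = christoffel z w v"
  by (simp add: christoffel_def mult_ac)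

lemma christoffel_metric:
  assumes "Im z > 0"
  shows "((\<lambda>z. hyp_inner z v w) has_derivative
           (\<lambda>u. hyp_inner z (christoffel z u v) w + hyp_inner z v (christoffel z u w))) (at z)"
proof -
  have "((\<lambda>z. hyp_inner z v w) has_derivative
           (\<lambda>u. - 2 * Im u * (v \<bullet> w) / (Im z) ^ 3)) (at z)"
    unfolding hyp_inner_def using assms
    by (auto intro!: derivative_eq_intros simp: divide_simps power2_eq_square power3_eq_cube)
  moreover have "- 2 * Im u * (v \<bullet> w) / (Im z) ^ 3 =
      hyp_inner z (christoffel z u v) w + hyp_inner z v (christoffel z u w)" for u
    using assms
    by (simp add: hyp_inner_def christoffel_def inner_complex_def field_simps
        power2_eq_square power3_eq_cube)
  ultimately show ?thesis by simp
qed

text \<open>\<open>cov_deriv p z v w\<close> is \<open>\<nabla>\<^sub>v(dp(w))\<close> at \<open>z\<close>, for constant vector fields \<open>v\<close> and \<open>w\<close>, where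
  \<open>\<nabla>\<close> is the pull-back by \<open>p\<close> of the Levi-Civita connection.\<close>

definition cov_deriv :: "(complex \<Rightarrow> complex) \<Rightarrow> complex \<Rightarrow> complex \<Rightarrow> complex \<Rightarrow> complex"
  where "cov_deriv p z v w =
     frechet_derivative (\<lambda>\<zeta>. dff p \<zeta> w) (at z) v + christoffel (p z) (dff p z v) (dff p z w)"

text \<open>
  Here \<open>(p, q)\<close> is a parametrized surface in the product of two hyperbolic planes, and \<open>(m, n)\<close> a
  tangent vector of the product at \<open>(p z, q z)\<close>.
\<close>

definition first_ff ::
    "(complex \<Rightarrow> complex) \<Rightarrow> (complex \<Rightarrow> complex) \<Rightarrow> complex \<Rightarrow> complex \<Rightarrow> complex \<Rightarrow> real"
  where "first_ff p q z v w =
     hyp_inner (p z) (dff p z v) (dff p z w) + hyp_inner (q z) (dff q z v) (dff q z w)"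

definition normal_to ::
    "(complex \<Rightarrow> complex) \<Rightarrow> (complex \<Rightarrow> complex) \<Rightarrow> complex \<Rightarrow> complex \<times> complex \<Rightarrow> bool"
  where "normal_to p q z N \<longleftrightarrow>
     (\<forall>v. hyp_inner (p z) (dff p z v) (fst N) + hyp_inner (q z) (dff q z v) (snd N) = 0)"

definition second_ff ::
    "(complex \<Rightarrow> complex) \<Rightarrow> (complex \<Rightarrow> complex) \<Rightarrow> complex \<Rightarrow> complex \<times> complex \<Rightarrow>
       complex \<Rightarrow> complex \<Rightarrow> real"
  where "second_ff p q z N v w =
     hyp_inner (p z) (cov_deriv p z v w) (fst N) + hyp_inner (q z) (cov_deriv q z v w) (snd N)"

text \<open>Half the trace of the second fundamental form in the direction \<open>N\<close> with respect to the first
  fundamental form, in the coordinate basis \<open>1, \<i>\<close>.\<close>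

definition mean_curvature ::
    "(complex \<Rightarrow> complex) \<Rightarrow> (complex \<Rightarrow> complex) \<Rightarrow> complex \<Rightarrow> complex \<times> complex \<Rightarrow> real"
  where "mean_curvature p q z N =
     (first_ff p q z \<i> \<i> * second_ff p q z N 1 1
        - 2 * first_ff p q z 1 \<i> * second_ff p q z N 1 \<i>
        + first_ff p q z 1 1 * second_ff p q z N \<i> \<i>)
     / (2 * (first_ff p q z 1 1 * first_ff p q z \<i> \<i> - (first_ff p q z 1 \<i>)\<^sup>2))"

definition minimal_surface :: "(complex \<Rightarrow> complex) \<Rightarrow> (complex \<Rightarrow> complex) \<Rightarrow> bool"
  where "minimal_surface p q \<longleftrightarrow>
     (\<forall>z\<in>half_plane. \<forall>N. normal_to p q z N \<longrightarrow> mean_curvature p q z N = 0)"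

text \<open>Invariance of the hyperbolic area form \<open>dx \<and> dy / y\<^sup>2\<close>.\<close>

definition area_preserving :: "(complex \<Rightarrow> complex) \<Rightarrow> bool"
  where "area_preserving f \<longleftrightarrow>
     (\<forall>z\<in>half_plane. \<forall>v w.
        oriented_area (dff f z v) (dff f z w) / (Im (f z))\<^sup>2 = oriented_area v w / (Im z)\<^sup>2)"

definition minimal_lagrangian :: "(complex \<Rightarrow> complex) \<Rightarrow> bool"
  where "minimal_lagrangian f \<longleftrightarrow>
     op_diffeo f \<and> area_preserving f \<and> minimal_surface (\<lambda>z. z) f"

end

theory Submission
  imports Defs
begin

text \<open>
  The counterexamples are the boundary maps \<open>\<phi> x = x ^ n\<close> for odd \<open>n\<close>.  Since a minimal Lagrangian
  map may be sought among those commuting with the translations along the axis from \<open>0\<close> to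
  \<open>\<infinity>\<close> up to a rescaling of the translation length, one is led to
  \<open>f (x + i y) = |z| ^ n (x + i n y) / |x + i n y|\<close>, which multiplies the radial logarithmic
  coordinate by \<open>n\<close> and is then forced in the angular direction by preservation of area.  In the
  frames \<open>z, i z\<close> and \<open>f z, i f z\<close> its differential is diagonal with entries between \<open>1 / n\<close>
  and \<open>n\<close>, so \<open>log K \<le> 2 log n\<close>.  But the harmonic quadruple \<open>0, 1, 2, \<infinity>\<close> is mapped to \<open>0, 1, 2 ^ n, \<infinity>\<close>,
  so the cross-ratio norm of \<open>\<phi>\<close> is at least \<open>log (2 ^ n - 1)\<close>, which grows linearly in \<open>n\<close>.
\<close>

section \<open>Power maps on the projective line\<close>


text \<open>Neighbourhoods of \<open>None\<close> are complements of closed compact sets, so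
  properness is exactly what continuity at \<open>None\<close> asks for.\<close>

lemma continuous_map_Alexandroff_map_option:
  assumes cont: "continuous_map X Y f"
    and proper: "\<And>C. \<lbrakk>compactin Y C; closedin Y C\<rbrakk> \<Longrightarrow> compactin X {x \<in> topspace X. f x \<in> C}"
  shows "continuous_map (Alexandroff_compactification X) (Alexandroff_compactification Y)
           (map_option f)"
proof -
  let ?X = "Alexandroff_compactification X"
  have "openin ?X {p \<in> topspace ?X. map_option f p \<in> V}"
    if "openin (Alexandroff_compactification Y) V" for V
    using that unfolding openin_Alexandroff_compactification[of Y]
  proof (elim disjE exE conjE)
    fix U assume U: "openin Y U" "V = Some ` U"
    then have "{p \<in> topspace ?X. map_option f p \<in> V} = Some ` {x \<in> topspace X. f x \<in> U}"
      by auto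
    then show ?thesis
      using openin_continuous_map_preimage[OF cont U(1)] by simp
  next
    fix C assume C: "compactin Y C" "closedin Y C" "V = insert None (Some ` (topspace Y - C))"
    have "f x \<in> topspace Y" if "x \<in> topspace X" for x
      using cont that by (auto simp: continuous_map_def)
    then have "{p \<in> topspace ?X. map_option f p \<in> V} =
        insert None (Some ` (topspace X - {x \<in> topspace X. f x \<in> C}))"
      using C(3) by auto
    then show ?thesis
      using proper[OF C(1,2)] closedin_continuous_map_preimage[OF cont C(2)]
      by (auto simp: openin_Alexandroff_compactification)
  qed
  moreover have "map_option f ` topspace ?X \<subseteq> topspace (Alexandroff_compactification Y)"
    using cont by (auto simp: continuous_map_def)
  ultimately show ?thesis
    by (auto simp: continuous_map_def)
qed

text \<open>In a Heine-Borel space, compact means closed and bounded, so properness reduces to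
  boundedness of preimages. The form with a closed set \<open>S\<close> serves both the projective
  line and the closed disc.\<close>

lemma continuous_map_Alexandroff_closed_subset:
  fixes f :: "'a::heine_borel \<Rightarrow> 'a"
  assumes "continuous_on S f" "f ` S \<subseteq> S" "closed S"
    and bounded_preimage: "\<And>B. bounded B \<Longrightarrow> bounded {x \<in> S. f x \<in> B}"
  shows "continuous_map (Alexandroff_compactification (top_of_set S))
           (Alexandroff_compactification (top_of_set S)) (map_option f)"
proof (rule continuous_map_Alexandroff_map_option)
  show "continuous_map (top_of_set S) (top_of_set S) f"
    using assms by auto
next
  fix C assume "compactin (top_of_set S) C"
  then have C: "compact C"
    by (simp add: compactin_subtopology)
  have "closed {x \<in> S. f x \<in> C}"
    using continuous_closed_preimage[OF assms(1,3) compact_imp_closed[OF C]]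
    by (simp add: vimage_def Int_def)
  then have "compact {x \<in> S. f x \<in> C}"
    using bounded_preimage[OF compact_imp_bounded[OF C]] by (simp add: compact_eq_bounded_closed)
  then show "compactin (top_of_set S) {x \<in> topspace (top_of_set S). f x \<in> C}"
    by (auto simp: compactin_subtopology)
qed

text \<open>For odd \<open>n\<close> the function \<open>root n\<close> is a two-sided inverse on
  all reals, and it is proper as well. Cyclic order is built from strict comparisons, each of which
  is preserved by a strictly increasing map fixing infinity.\<close>

lemma op_homeo_power:
  assumes "odd n"
  shows "op_homeo_RP1 (map_option (\<lambda>x. x ^ n))"
proof -
  have n: "n > 0" using assms odd_pos by blast
  have bd: "bounded {x::real. g x \<in> B}"
    if B: "bounded B" and g: "\<And>x y. \<bar>g x\<bar> \<le> y \<Longrightarrow> \<bar>x\<bar> \<le> h y" for B and g h :: "real \<Rightarrow> real"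
  proof -
    obtain b where "\<And>y. y \<in> B \<Longrightarrow> \<bar>y\<bar> \<le> b"
      using B by (auto simp: bounded_real)
    then show ?thesis using g by (auto simp: bounded_real)
  qed
  have RP1: "RP1 = Alexandroff_compactification (top_of_set (UNIV::real set))"
    by (simp add: RP1_def)
  have "continuous_map RP1 RP1 (map_option (\<lambda>x. x ^ n))"
    unfolding RP1
  proof (rule continuous_map_Alexandroff_closed_subset)
    fix B :: "real set" assume "bounded B"
    moreover have "\<bar>x\<bar> \<le> root n y" if "\<bar>x ^ n\<bar> \<le> y" for x y :: real
      using that real_root_le_iff[OF n, of "\<bar>x\<bar> ^ n" y] real_root_power_cancel[OF n, of "\<bar>x\<bar>"]
      by (simp add: power_abs)
    ultimately show "bounded {x \<in> UNIV. x ^ n \<in> B}"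
      using bd[of B "\<lambda>x. x ^ n" "root n"] by auto
  qed (auto intro!: continuous_intros)
  moreover have "continuous_map RP1 RP1 (map_option (root n))"
    unfolding RP1
  proof (rule continuous_map_Alexandroff_closed_subset)
    fix B :: "real set" assume "bounded B"
    moreover have "\<bar>x\<bar> \<le> y ^ n" if "\<bar>root n x\<bar> \<le> y" for x y :: real
      using power_mono[OF that, of n] n assms
      by (metis abs_ge_zero odd_real_root_pow power_abs)
    ultimately show "bounded {x \<in> UNIV. root n x \<in> B}"
      using bd[of B "root n" "\<lambda>y. y ^ n"] by auto
  qed (auto intro!: continuous_intros)
  ultimately have "homeomorphic_map RP1 RP1 (map_option (\<lambda>x. x ^ n))"
    by (rule_tac homeomorphic_maps_imp_map[of _ _ _ "map_option (root n)"])
      (auto simp: homeomorphic_maps_def option.map_comp o_def odd_real_root_power_cancel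
        odd_real_root_pow assms option.map_ident)
  moreover have less: "x ^ n < y ^ n" if "x < y" for x y :: real
    using power_mono_odd[OF assms, of x y] odd_real_root_power_cancel[OF assms] that
    by (metis less_le)
  then have "rp_ereal (map_option (\<lambda>x. x ^ n) p) < rp_ereal (map_option (\<lambda>x. x ^ n) q)"
    if "rp_ereal p < rp_ereal q" for p q
    using that less
    by (cases p; cases q) (auto simp: rp_ereal_def)
  ultimately show ?thesis
    by (auto simp: op_homeo_RP1_def cyc_ordered_def)
qed

section \<open>Homogeneous coordinates and the distortion of cross-ratios by power maps\<close>

fun hom_x :: "real option \<Rightarrow> real" where "hom_x None = 1" | "hom_x (Some x) = x"
fun hom_w :: "real option \<Rightarrow> real" where "hom_w None = 0" | "hom_w (Some x) = 1"

text \<open>The larger of the two terms whose difference is \<open>pdiff p q\<close>. Its power of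
  exponent \<open>n - 1\<close> measures how much the power map scales \<open>pdiff p q\<close>,
  uniformly up to infinity.\<close>

definition hom_max :: "real option \<Rightarrow> real option \<Rightarrow> real"
  where "hom_max p q = max \<bar>hom_x p * hom_w q\<bar> \<bar>hom_x q * hom_w p\<bar>"

lemma pdiff_eq: "pdiff p q = hom_x p * hom_w q - hom_x q * hom_w p"
  by (cases p; cases q) auto

text \<open>The power map acts coordinatewise on homogeneous coordinates; \<open>n > 0\<close> keeps
  the vanishing coordinate of infinity equal to 0.\<close>

lemma pdiff_power_eq:
  assumes "n > 0"
  shows "pdiff (map_option (\<lambda>x. x ^ n) p) (map_option (\<lambda>x. x ^ n) q) =
    (hom_x p * hom_w q) ^ n - (hom_x q * hom_w p) ^ n"
  using assms by (cases p; cases q) (auto simp: power_0_left)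

text \<open>Factor out \<open>u - v\<close>: the cofactor is a sum of \<open>n\<close> monomials of
  degree \<open>n - 1\<close>.\<close>

lemma abs_power_diff_le:
  fixes u v :: real
  assumes "\<bar>u\<bar> \<le> M" "\<bar>v\<bar> \<le> M"
  shows "\<bar>u ^ n - v ^ n\<bar> \<le> n * M ^ (n - 1) * \<bar>u - v\<bar>"
proof -
  have "\<bar>v ^ (n - Suc i) * u ^ i\<bar> \<le> M ^ (n - 1)" if "i < n" for i
  proof -
    have "\<bar>v ^ (n - Suc i) * u ^ i\<bar> \<le> M ^ (n - Suc i) * M ^ i"
      unfolding abs_mult power_abs using assms by (intro mult_mono power_mono) auto
    also have "\<dots> = M ^ (n - 1)"
      using that by (simp flip: power_add)
    finally show ?thesis .
  qed
  then have "\<bar>\<Sum>i<n. v ^ (n - Suc i) * u ^ i\<bar> \<le> (\<Sum>i<n. M ^ (n - 1))"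
    by (intro order.trans[OF sum_abs] sum_mono) auto
  then have "\<bar>u - v\<bar> * \<bar>\<Sum>i<n. v ^ (n - Suc i) * u ^ i\<bar> \<le> \<bar>u - v\<bar> * (n * M ^ (n - 1))"
    by (intro mult_left_mono) auto
  then show ?thesis
    by (simp add: power_diff_sumr2 abs_mult mult_ac)
qed

text \<open>If the signs agree, the smaller power can be compared with \<bar>v\<bar> times the
  larger factor, and no constant is lost. If they differ, oddness turns the difference into a sum of
  absolute values, while \<bar>u - v\<bar> is at most twice the larger modulus; this is the source
  of the factor 1/2.\<close>

lemma abs_power_diff_ge:
  fixes u v :: real
  assumes "odd n"
  shows "max \<bar>u\<bar> \<bar>v\<bar> ^ (n - 1) * \<bar>u - v\<bar> / 2 \<le> \<bar>u ^ n - v ^ n\<bar>"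
proof -
  obtain m where m: "n = Suc m" "even m"
    using assms by (metis even_Suc odd_pos gr0_implies_Suc)
  have main: "\<bar>u\<bar> ^ m * \<bar>u - v\<bar> / 2 \<le> \<bar>u ^ n - v ^ n\<bar>" if le: "\<bar>v\<bar> \<le> \<bar>u\<bar>" for u v :: real
  proof -
    have um: "u ^ m = \<bar>u\<bar> ^ m" "v ^ m = \<bar>v\<bar> ^ m"
      using m(2) by (simp_all add: power_even_abs)
    have vm: "0 \<le> \<bar>v\<bar> ^ m" "\<bar>v\<bar> ^ m \<le> \<bar>u\<bar> ^ m"
      using le by (auto intro: power_mono)
    have eq: "u ^ n - v ^ n = u * \<bar>u\<bar> ^ m - v * \<bar>v\<bar> ^ m"
      using m(1) um by simp
    show ?thesis
    proof (cases "0 \<le> u * v")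
      case True
      have "\<bar>u ^ n - v ^ n\<bar> = \<bar>u\<bar> * \<bar>u\<bar> ^ m - \<bar>v\<bar> * \<bar>v\<bar> ^ m"
        unfolding eq using True le vm mult_mono[OF le vm(2)]
        by (cases "u \<ge> 0"; cases "v \<ge> 0") (auto simp: zero_le_mult_iff abs_if split: if_splits)
      moreover have "\<bar>v\<bar> * \<bar>v\<bar> ^ m \<le> \<bar>v\<bar> * \<bar>u\<bar> ^ m"
        using vm by (intro mult_left_mono) auto
      moreover have "\<bar>u - v\<bar> = \<bar>u\<bar> - \<bar>v\<bar>"
        using True le by (auto simp: zero_le_mult_iff abs_if split: if_splits)
      then have "\<bar>u\<bar> ^ m * \<bar>u - v\<bar> = \<bar>u\<bar> * \<bar>u\<bar> ^ m - \<bar>v\<bar> * \<bar>u\<bar> ^ m"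
        by (simp flip: left_diff_distrib)
      moreover have "0 \<le> \<bar>u\<bar> ^ m * \<bar>u - v\<bar>" by simp
      ultimately show ?thesis
        by linarith
    next
      case False
      have "\<bar>u ^ n - v ^ n\<bar> = \<bar>u\<bar> * \<bar>u\<bar> ^ m + \<bar>v\<bar> * \<bar>v\<bar> ^ m"
      proof (cases "u > 0")
        case True
        then have "v < 0" using False by (simp add: not_le mult_less_0_iff)
        then have "v * \<bar>v\<bar> ^ m \<le> 0" "0 \<le> u * \<bar>u\<bar> ^ m"
          using True by (simp_all add: mult_nonpos_nonneg)
        then have "\<bar>u ^ n - v ^ n\<bar> = u * \<bar>u\<bar> ^ m - v * \<bar>v\<bar> ^ m"
          unfolding eq by linarith
        then show ?thesis
          using True \<open>v < 0\<close> by simp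
      next
        case neg: False
        then have "v > 0" "u < 0" using False by (auto simp: not_le mult_less_0_iff)
        then have "u * \<bar>u\<bar> ^ m \<le> 0" "0 \<le> v * \<bar>v\<bar> ^ m"
          by (simp_all add: mult_nonpos_nonneg)
        then have "\<bar>u ^ n - v ^ n\<bar> = v * \<bar>v\<bar> ^ m - u * \<bar>u\<bar> ^ m"
          unfolding eq by linarith
        then show ?thesis
          using \<open>u < 0\<close> \<open>v > 0\<close> by simp
      qed
      moreover have "\<bar>u\<bar> ^ m * \<bar>u - v\<bar> \<le> \<bar>u\<bar> ^ m * (2 * \<bar>u\<bar>)"
        using le by (intro mult_left_mono) auto
      then have "\<bar>u\<bar> ^ m * \<bar>u - v\<bar> \<le> 2 * (\<bar>u\<bar> * \<bar>u\<bar> ^ m)"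
        by (simp add: mult_ac)
      moreover have "0 \<le> \<bar>v\<bar> * \<bar>v\<bar> ^ m" by simp
      ultimately show ?thesis
        by linarith
    qed
  qed
  show ?thesis
    using main[of u v] main[of v u] m(1)
    by (auto simp: max_def abs_minus_commute)
qed

text \<open>
  Of the four terms in the expansion of the left-hand product, two also occur on the right, and the
  other two have a product which is that of two terms on the right; so at least one of them is
  small, and the cross-ratio hypothesis bounds their sum.
\<close>

lemma hom_max_product_le:
  assumes eq: "\<bar>pdiff p1 p4 * pdiff p3 p2\<bar> = \<bar>pdiff p1 p2 * pdiff p3 p4\<bar>"
  shows "hom_max p1 p4 * hom_max p3 p2 \<le> 7 * (hom_max p1 p2 * hom_max p3 p4)"
proof -
  define R where "R = hom_max p1 p2 * hom_max p3 p4"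
  let ?P = "hom_x p3 * hom_x p4 * hom_w p1 * hom_w p2" and ?Q = "hom_x p1 * hom_x p2 * hom_w p3 * hom_w p4"
  let ?S = "hom_x p1 * hom_x p3 * hom_w p2 * hom_w p4" and ?T = "hom_x p2 * hom_x p4 * hom_w p1 * hom_w p3"
  let ?U = "hom_x p1 * hom_x p4 * hom_w p2 * hom_w p3" and ?V = "hom_x p2 * hom_x p3 * hom_w p1 * hom_w p4"
  have R: "\<bar>?S\<bar> \<le> R" "\<bar>?T\<bar> \<le> R" "\<bar>?U\<bar> \<le> R" "\<bar>?V\<bar> \<le> R"
    unfolding R_def hom_max_def by (simp_all add: max_mult_distrib_left max_mult_distrib_right
        abs_mult mult_ac le_max_iff_disj)
  have "R \<ge> 0"
    using order.trans[OF abs_ge_zero R(1)] .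
  have "\<bar>?P\<bar> * \<bar>?Q\<bar> = \<bar>?S\<bar> * \<bar>?T\<bar>"
    by (simp add: abs_mult mult_ac)
  also have "\<dots> \<le> R * R"
    using R by (intro mult_mono) auto
  finally have PQ: "\<bar>?P\<bar> * \<bar>?Q\<bar> \<le> R * R" .
  have small: "\<bar>?P\<bar> \<le> R \<or> \<bar>?Q\<bar> \<le> R"
  proof (rule ccontr)
    assume "\<not> ?thesis"
    then have "R * R < \<bar>?P\<bar> * \<bar>?Q\<bar>"
      using \<open>R \<ge> 0\<close> by (intro mult_strict_mono) auto
    then show False using PQ by simp
  qed
  have "pdiff p1 p4 * pdiff p3 p2 = ?S + ?T - ?P - ?Q"
    "pdiff p1 p2 * pdiff p3 p4 = ?S - ?U - ?V + ?T"
    unfolding pdiff_eq by (simp_all add: algebra_simps)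
  moreover have "\<bar>?S - ?U - ?V + ?T\<bar> \<le> 4 * R"
    using R unfolding abs_le_iff by linarith
  ultimately have "\<bar>?S + ?T - ?P - ?Q\<bar> \<le> 4 * R"
    using eq by simp
  \<comment> \<open>Here 7 = 4 + 3: the whole expression is at most \<open>4 * R\<close>, and
    \<open>?S\<close>, \<open>?T\<close> and the small one of \<open>?P\<close>, \<open>?Q\<close>
    contribute at most \<open>R\<close> each.\<close>
  then have "\<bar>?P\<bar> \<le> 7 * R" "\<bar>?Q\<bar> \<le> 7 * R"
    using small R unfolding abs_le_iff by linarith+
  moreover have "\<bar>?S\<bar> \<le> 7 * R" "\<bar>?T\<bar> \<le> 7 * R"
    using R \<open>R \<ge> 0\<close> by (auto intro: order.trans)
  moreover have "max a b * max c d \<le> 7 * R"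
    if "a * c \<le> 7 * R" "a * d \<le> 7 * R" "b * c \<le> 7 * R" "b * d \<le> 7 * R" for a b c d
    using that by (simp add: max_def)
  ultimately have "hom_max p1 p4 * hom_max p3 p2 \<le> 7 * R"
    unfolding hom_max_def by (simp add: abs_mult mult_ac)
  then show ?thesis
    by (simp add: R_def)
qed


lemma hom_max_nonneg: "hom_max p q \<ge> 0"
  by (simp add: hom_max_def le_max_iff_disj)

lemma abs_pdiff_power_le:
  assumes "n > 0"
  shows "\<bar>pdiff (map_option (\<lambda>x. x ^ n) p) (map_option (\<lambda>x. x ^ n) q)\<bar> \<le>
    n * hom_max p q ^ (n - 1) * \<bar>pdiff p q\<bar>"
  unfolding pdiff_power_eq[OF assms] unfolding pdiff_eq
  by (rule abs_power_diff_le) (auto simp: hom_max_def)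

lemma abs_pdiff_power_ge:
  assumes "odd n"
  shows "hom_max p q ^ (n - 1) * \<bar>pdiff p q\<bar> / 2 \<le>
    \<bar>pdiff (map_option (\<lambda>x. x ^ n) p) (map_option (\<lambda>x. x ^ n) q)\<bar>"
  unfolding pdiff_power_eq[OF odd_pos[OF assms]] unfolding pdiff_eq hom_max_def
  by (rule abs_power_diff_ge[OF assms])

lemma abs_pdiff_commute: "\<bar>pdiff p q\<bar> = \<bar>pdiff q p\<bar>"
  by (simp add: pdiff_eq abs_minus_commute)

text \<open>Upper estimates for the two factors on the left give \<open>n ^ 2\<close>, lower
  estimates for the two on the right give 4, and comparing the products of \<open>hom_max\<close>
  gives \<open>7 ^ (n - 1)\<close>. The hypothesis is symmetric under exchange of \<open>p2\<close>
  and \<open>p4\<close>, so the estimate can be used in both directions.\<close>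

lemma pdiff_power_product_le:
  fixes n
  defines "\<phi> \<equiv> map_option (\<lambda>x::real. x ^ n)"
  assumes "odd n"
    and eq: "\<bar>pdiff p1 p4 * pdiff p3 p2\<bar> = \<bar>pdiff p1 p2 * pdiff p3 p4\<bar>"
  shows "\<bar>pdiff (\<phi> p1) (\<phi> p4) * pdiff (\<phi> p3) (\<phi> p2)\<bar> \<le>
    4 * n ^ 2 * 7 ^ (n - 1) * \<bar>pdiff (\<phi> p1) (\<phi> p2) * pdiff (\<phi> p3) (\<phi> p4)\<bar>"
proof -
  have "\<bar>pdiff (\<phi> p1) (\<phi> p4) * pdiff (\<phi> p3) (\<phi> p2)\<bar> \<le>
    (n * hom_max p1 p4 ^ (n - 1) * \<bar>pdiff p1 p4\<bar>) * (n * hom_max p3 p2 ^ (n - 1) * \<bar>pdiff p3 p2\<bar>)"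
    unfolding abs_mult \<phi>_def using odd_pos[OF \<open>odd n\<close>]
    by (intro mult_mono abs_pdiff_power_le) (auto simp: hom_max_nonneg)
  also have "\<dots> = n ^ 2 * \<bar>pdiff p1 p4 * pdiff p3 p2\<bar> * (hom_max p1 p4 * hom_max p3 p2) ^ (n - 1)"
    by (simp add: power2_eq_square power_mult_distrib abs_mult mult_ac)
  also have "\<dots> \<le> n ^ 2 * \<bar>pdiff p1 p4 * pdiff p3 p2\<bar> * (7 * (hom_max p1 p2 * hom_max p3 p4)) ^ (n - 1)"
    by (intro mult_left_mono power_mono hom_max_product_le eq) (auto simp: hom_max_nonneg)
  also have "\<dots> = 4 * n ^ 2 * 7 ^ (n - 1) *
    ((hom_max p1 p2 ^ (n - 1) * \<bar>pdiff p1 p2\<bar> / 2) * (hom_max p3 p4 ^ (n - 1) * \<bar>pdiff p3 p4\<bar> / 2))"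
    unfolding eq by (simp add: power2_eq_square power_mult_distrib abs_mult mult_ac)
  also have "\<dots> \<le> 4 * n ^ 2 * 7 ^ (n - 1) *
     (\<bar>pdiff (\<phi> p1) (\<phi> p2)\<bar> * \<bar>pdiff (\<phi> p3) (\<phi> p4)\<bar>)"
    unfolding \<phi>_def
    by (intro mult_left_mono mult_mono abs_pdiff_power_ge \<open>odd n\<close>) (auto simp: hom_max_nonneg)
  finally show ?thesis
    by (simp add: abs_mult)
qed

lemma quasisymmetric_power:
  assumes "odd n"
  shows "quasisymmetric (map_option (\<lambda>x. x ^ n))"
proof -
  let ?\<phi> = "map_option (\<lambda>x::real. x ^ n)"
  define B where "B = 4 * real n ^ 2 * 7 ^ (n - 1)"
  have bound: "\<bar>ln \<bar>cross_ratio (?\<phi> p1) (?\<phi> p2) (?\<phi> p3) (?\<phi> p4)\<bar>\<bar> \<le> ln B"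
    if cr: "cross_ratio p1 p2 p3 p4 = - 1" for p1 p2 p3 p4
  proof -
    define D where "D p q = \<bar>pdiff (?\<phi> p) (?\<phi> q)\<bar>" for p q
    \<comment> \<open>A zero denominator would make the cross-ratio 0, by the convention for
      division by zero.\<close>
    have nz: "pdiff p2 p1 * pdiff p3 p4 \<noteq> 0"
      using cr by (auto simp: cross_ratio_def)
    have "pdiff p4 p1 * pdiff p3 p2 = - (pdiff p2 p1 * pdiff p3 p4)"
      using cr nz by (simp add: cross_ratio_def divide_eq_eq)
    then have eq: "\<bar>pdiff p1 p4 * pdiff p3 p2\<bar> = \<bar>pdiff p1 p2 * pdiff p3 p4\<bar>"
      by (simp add: pdiff_eq algebra_simps)
    have "inj (\<lambda>x::real. x ^ n)"
      using odd_real_root_power_cancel[OF assms] by (rule inj_on_inverseI)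
    then have "inj ?\<phi>"
      by (rule option.inj_map)
    note injD[OF this]
    moreover have "pdiff p q = 0 \<longleftrightarrow> p = q" for p q
      by (cases p; cases q) auto
    ultimately have inj: "pdiff (?\<phi> p) (?\<phi> q) = 0 \<Longrightarrow> pdiff p q = 0" for p q
      by blast
    have pos: "D p1 p2 * D p3 p4 > 0"
      unfolding D_def using nz inj[of p1 p2] inj[of p3 p4] abs_pdiff_commute[of p1 p2]
      by (intro mult_pos_pos) auto
    have "pdiff p1 p4 * pdiff p3 p2 \<noteq> 0"
      using eq nz abs_pdiff_commute[of p1 p2] by auto
    then have pos': "D p1 p4 * D p3 p2 > 0"
      unfolding D_def using inj[of p1 p4] inj[of p3 p2] by (intro mult_pos_pos) auto
    have le: "D p1 p4 * D p3 p2 \<le> B * (D p1 p2 * D p3 p4)"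
      using pdiff_power_product_le[OF assms eq] by (simp add: D_def B_def abs_mult)
    \<comment> \<open>The same estimate with \<open>p2\<close> and \<open>p4\<close> exchanged
      bounds the inverse of the image cross-ratio.\<close>
    have ge: "D p1 p2 * D p3 p4 \<le> B * (D p1 p4 * D p3 p2)"
      using pdiff_power_product_le[OF assms eq[symmetric]] by (simp add: D_def B_def abs_mult)
    have B: "B > 0"
      using odd_pos[OF assms] by (simp add: B_def)
    define X where "X = (D p1 p4 * D p3 p2) / (D p1 p2 * D p3 p4)"
    have X: "\<bar>cross_ratio (?\<phi> p1) (?\<phi> p2) (?\<phi> p3) (?\<phi> p4)\<bar> = X"
      by (simp add: cross_ratio_def X_def D_def abs_mult abs_pdiff_commute)
    have "X > 0" "X \<le> B" "1 / B \<le> X"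
      using pos pos' le ge B by (auto simp: X_def divide_simps mult_ac)
    then have "ln X \<le> ln B" "ln (1 / B) \<le> ln X"
      using B by (auto simp: ln_le_cancel_iff)
    then show ?thesis
      unfolding X using B by (simp add: ln_div abs_le_iff)
  qed
  have "cr_norm ?\<phi> \<le> ereal (ln B)"
    unfolding cr_norm_def using bound by (auto intro!: SUP_least)
  then show ?thesis
    using op_homeo_power[OF assms] by (auto simp: quasisymmetric_def)
qed

lemma cr_norm_power_ge:
  "cr_norm (map_option (\<lambda>x. x ^ n)) \<ge> ereal (ln (2 ^ n - 1))" if "n > 0"
proof -
  let ?Q = "(Some 0, Some 1, Some 2, None) :: real option \<times> real option \<times> real option \<times> real option"
  have "ereal \<bar>ln (2 ^ n - 1)\<bar> \<le> cr_norm (map_option (\<lambda>x. x ^ n))"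
    unfolding cr_norm_def
    by (rule SUP_upper2[where i = ?Q]) (use that in \<open>auto simp: cross_ratio_def power_0_left\<close>)
  then show ?thesis
    by (meson abs_ge_self ereal_less_eq(3) order_trans)
qed


section \<open>The stretch maps\<close>

lemma Ck_on_cong:
  assumes "open S" "\<And>z. z \<in> S \<Longrightarrow> f z = g z" "Ck_on k S f"
  shows "Ck_on k S g"
  using assms(2,3)
proof (induction k arbitrary: f g)
  case 0
  show ?case
    using continuous_on_eq[of S f g] 0 unfolding Ck_on.simps by blast
next
  case (Suc k)
  have der: "(g has_derivative dff f z) (at z)" if "z \<in> S" for z
  proof (rule has_derivative_transform_within_open[OF _ \<open>open S\<close> that])
    show "(f has_derivative dff f z) (at z)"
      using Suc.prems(2) that by (simp only: Ck_on.simps frechet_derivative_works)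
  qed (rule Suc.prems(1))
  have eq: "dff f z = dff g z" if "z \<in> S" for z
    by (rule frechet_derivative_at[OF der[OF that]])
  have "Ck_on k S (\<lambda>z. dff g z v)" for v
    by (rule Suc.IH[of "\<lambda>z. dff f z v"]) (use eq Suc.prems(2) in \<open>simp_all only: Ck_on.simps\<close>)
  then show ?case
    using der unfolding Ck_on.simps differentiable_def by blast
qed

text \<open>Polynomials in the two real coordinates, with complex coefficients. They serve as the
  coefficients in a class of functions stable under real directional derivatives.\<close>

inductive planar_poly :: "(complex \<Rightarrow> complex) \<Rightarrow> bool" where
  const: "planar_poly (\<lambda>z. c)"
| Re: "planar_poly (\<lambda>z. of_real (Re z))"
| Im: "planar_poly (\<lambda>z. of_real (Im z))"
| add: "planar_poly P \<Longrightarrow> planar_poly Q \<Longrightarrow> planar_poly (\<lambda>z. P z + Q z)"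
| mult: "planar_poly P \<Longrightarrow> planar_poly Q \<Longrightarrow> planar_poly (\<lambda>z. P z * Q z)"

lemma planar_poly_derivative:
  assumes "planar_poly P"
  shows "\<exists>P'. (\<forall>z. (P has_derivative P' z) (at z)) \<and> (\<forall>v. planar_poly (\<lambda>z. P' z v))"
  using assms
proof induction
  case (const c)
  show ?case
    by (rule exI[of _ "\<lambda>z v. 0"]) (auto intro: planar_poly.const)
next
  case Re
  have "((\<lambda>z. complex_of_real (Re z)) has_derivative (\<lambda>v. of_real (Re v))) (at z)" for z
    by (auto intro!: derivative_eq_intros)
  then show ?case
    by (intro exI[of _ "\<lambda>z v. of_real (Re v)"]) (auto intro: planar_poly.const)
next
  case Im
  have "((\<lambda>z. complex_of_real (Im z)) has_derivative (\<lambda>v. of_real (Im v))) (at z)" for z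
    by (auto intro!: derivative_eq_intros)
  then show ?case
    by (intro exI[of _ "\<lambda>z v. of_real (Im v)"]) (auto intro: planar_poly.const)
next
  case (add P Q)
  then obtain P' Q' where
    "\<And>z. (P has_derivative P' z) (at z)" "\<And>v. planar_poly (\<lambda>z. P' z v)"
    "\<And>z. (Q has_derivative Q' z) (at z)" "\<And>v. planar_poly (\<lambda>z. Q' z v)" by blast
  then show ?case
    by (intro exI[of _ "\<lambda>z v. P' z v + Q' z v"])
      (auto intro: planar_poly.intros has_derivative_add)
next
  case (mult P Q)
  then obtain P' Q' where
    "\<And>z. (P has_derivative P' z) (at z)" "\<And>v. planar_poly (\<lambda>z. P' z v)"
    "\<And>z. (Q has_derivative Q' z) (at z)" "\<And>v. planar_poly (\<lambda>z. Q' z v)" by blast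
  then show ?case
    using mult.hyps by (intro exI[of _ "\<lambda>z v. P z * Q' z v + P' z v * Q z"])
      (auto intro!: planar_poly.add planar_poly.mult has_derivative_mult)
qed

text \<open>For \<open>p = q = 1\<close> this is the squared modulus of \<open>z\<close>; in general
  it is the squared modulus after scaling the two axes. Real powers of two such forms are the only
  non-polynomial factors of the stretch maps.\<close>

definition diag_form :: "real \<Rightarrow> real \<Rightarrow> complex \<Rightarrow> real"
  where "diag_form p q z = (p * Re z)\<^sup>2 + (q * Im z)\<^sup>2"

definition diag_form_deriv :: "real \<Rightarrow> real \<Rightarrow> complex \<Rightarrow> complex \<Rightarrow> real"
  where "diag_form_deriv p q z v = 2 * p\<^sup>2 * Re z * Re v + 2 * q\<^sup>2 * Im z * Im v"

lemma diag_form_pos: "p > 0 \<Longrightarrow> q > 0 \<Longrightarrow> z \<noteq> 0 \<Longrightarrow> diag_form p q z > 0"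
  unfolding diag_form_def by (auto simp: complex_eq_iff sum_power2_gt_zero_iff)

lemma has_derivative_diag_form [derivative_intros]:
  "(diag_form p q has_derivative diag_form_deriv p q z) (at z)"
  unfolding diag_form_def diag_form_deriv_def
  by (auto intro!: derivative_eq_intros simp: power2_eq_square algebra_simps)

lemma planar_poly_diag_form: "planar_poly (\<lambda>z. of_real (diag_form p q z))"
  "planar_poly (\<lambda>z. of_real (diag_form_deriv p q z v))"
  unfolding diag_form_def diag_form_deriv_def power2_eq_square of_real_add of_real_mult
  by (intro planar_poly.intros)+

lemma powr_eq_mult: "x > 0 \<Longrightarrow> x powr b = x powr (b - 1) * x" for x :: real
  by (simp add: powr_diff)

text \<open>
  For fixed \<open>p\<close> and \<open>q\<close>, the functions \<open>weighted p q \<alpha> \<beta> P\<close> with \<open>P\<close> polynomial form a class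
  closed under directional derivatives, which yields smoothness by induction.
\<close>

definition weighted :: "real \<Rightarrow> real \<Rightarrow> real \<Rightarrow> real \<Rightarrow> (complex \<Rightarrow> complex) \<Rightarrow> complex \<Rightarrow> complex"
  where "weighted p q \<alpha> \<beta> P z = P z * of_real (diag_form 1 1 z powr \<alpha> * diag_form p q z powr \<beta>)"

text \<open>Both exponents drop by one and the common powers are pulled out, so that what remains in
  front is again polynomial whenever \<open>P\<close> is.\<close>

lemma has_derivative_weighted:
  assumes "p > 0" "q > 0" "z \<noteq> 0" "(P has_derivative P') (at z)"
  shows "(weighted p q \<alpha> \<beta> P has_derivative
    (\<lambda>v. (P' v * of_real (diag_form 1 1 z) * of_real (diag_form p q z)
          + P z * (of_real \<alpha> * of_real (diag_form_deriv 1 1 z v) * of_real (diag_form p q z)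
                 + of_real \<beta> * of_real (diag_form_deriv p q z v) * of_real (diag_form 1 1 z)))
        * of_real (diag_form 1 1 z powr (\<alpha> - 1) * diag_form p q z powr (\<beta> - 1)))) (at z)"
proof -
  have pos: "diag_form 1 1 z > 0" "diag_form p q z > 0"
    using assms diag_form_pos by auto
  have eq: "diag_form 1 1 z powr \<alpha> = diag_form 1 1 z powr (\<alpha> - 1) * diag_form 1 1 z"
    "diag_form p q z powr \<beta> = diag_form p q z powr (\<beta> - 1) * diag_form p q z"
    using pos by (simp_all add: powr_diff)
  have "((\<lambda>z. diag_form 1 1 z powr \<alpha> * diag_form p q z powr \<beta>) has_derivative
     (\<lambda>v. (\<alpha> * diag_form_deriv 1 1 z v * diag_form p q z + \<beta> * diag_form_deriv p q z v * diag_form 1 1 z) *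
        (diag_form 1 1 z powr (\<alpha> - 1) * diag_form p q z powr (\<beta> - 1)))) (at z)"
    using pos
    by (auto intro!: derivative_eq_intros simp: eq fun_eq_iff field_simps)
  note has_derivative_mult[OF assms(4) has_derivative_of_real[OF this]]
  moreover have "weighted p q \<alpha> \<beta> P = (\<lambda>z. P z * of_real (diag_form 1 1 z powr \<alpha> * diag_form p q z powr \<beta>))"
    by (auto simp: weighted_def)
  ultimately show ?thesis
    by (auto simp: eq algebra_simps elim!: has_derivative_eq_rhs)
qed

lemma Ck_on_weighted:
  assumes "p > 0" "q > 0" "open S" "0 \<notin> S" "planar_poly P"
  shows "Ck_on k S (weighted p q \<alpha> \<beta> P)"
  using \<open>planar_poly P\<close>
proof (induction k arbitrary: P \<alpha> \<beta>)
  case 0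
  then obtain P' where P': "\<And>z. (P has_derivative P' z) (at z)"
    using planar_poly_derivative by blast
  have "continuous (at z) (weighted p q \<alpha> \<beta> P)" if "z \<in> S" for z
  proof -
    have "z \<noteq> 0" using that assms(4) by auto
    from has_derivative_weighted[OF assms(1,2) this P'] show ?thesis
      by (rule has_derivative_continuous)
  qed
  then show ?case
    by (simp add: continuous_at_imp_continuous_on)
next
  case (Suc k)
  then obtain P' where P': "\<And>z. (P has_derivative P' z) (at z)" "\<And>v. planar_poly (\<lambda>z. P' z v)"
    using planar_poly_derivative by blast
  have der: "(weighted p q \<alpha> \<beta> P has_derivative
      (\<lambda>v. weighted p q (\<alpha> - 1) (\<beta> - 1) (\<lambda>z. P' z v * of_real (diag_form 1 1 z) * of_real (diag_form p q z)
          + P z * (of_real \<alpha> * of_real (diag_form_deriv 1 1 z v) * of_real (diag_form p q z)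
                 + of_real \<beta> * of_real (diag_form_deriv p q z v) * of_real (diag_form 1 1 z))) z)) (at z)"
    if "z \<in> S" for z
    unfolding weighted_def[of p q "\<alpha> - 1"]
    using that assms by (intro has_derivative_weighted P') auto
  show ?case
    unfolding Ck_on.simps
  proof (intro conjI ballI allI)
    fix v
    have "Ck_on k S (weighted p q (\<alpha> - 1) (\<beta> - 1)
      (\<lambda>z. P' z v * of_real (diag_form 1 1 z) * of_real (diag_form p q z)
          + P z * (of_real \<alpha> * of_real (diag_form_deriv 1 1 z v) * of_real (diag_form p q z)
                 + of_real \<beta> * of_real (diag_form_deriv p q z v) * of_real (diag_form 1 1 z))))"
      by (intro Suc.IH planar_poly.intros planar_poly_diag_form P' Suc.prems)
    then show "Ck_on k S (\<lambda>z. dff (weighted p q \<alpha> \<beta> P) z v)"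
      by (rule Ck_on_cong[OF \<open>open S\<close>, rotated]) (rule fun_cong[OF frechet_derivative_at[OF der]])
  next
    fix z assume "z \<in> S"
    then show "weighted p q \<alpha> \<beta> P differentiable at z"
      using der unfolding differentiable_def by blast
  qed
qed

section \<open>The stretch maps, their inverses and their differentials\<close>

text \<open>The image has modulus \<open>cmod z powr a\<close> and the direction of
  \<open>Complex (p * Re z) (q * Im z)\<close>. The maps of interest are
  \<open>stretch a 1 a\<close>; the extra parameters put the inverse
  \<open>stretch (1 / a) a 1\<close> into the same family.\<close>

definition stretch :: "real \<Rightarrow> real \<Rightarrow> real \<Rightarrow> complex \<Rightarrow> complex"
  where "stretch a p q = weighted p q (a / 2) (- 1 / 2) (\<lambda>z. Complex (p * Re z) (q * Im z))"

lemma open_half_plane: "open half_plane"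
  by (simp add: half_plane_def open_halfspace_Im_gt)

lemma smooth_on_stretch:
  assumes "p > 0" "q > 0"
  shows "smooth_on half_plane (stretch a p q)"
proof -
  have "planar_poly (\<lambda>z. of_real p * of_real (Re z) + \<i> * of_real q * of_real (Im z))"
    by (intro planar_poly.intros)
  moreover have "(\<lambda>z. of_real p * of_real (Re z) + \<i> * of_real q * of_real (Im z)) =
      (\<lambda>z. Complex (p * Re z) (q * Im z))"
    by (auto simp: complex_eq_iff)
  ultimately show ?thesis
    unfolding smooth_on_def stretch_def
    using assms open_half_plane by (auto intro!: Ck_on_weighted simp: half_plane_def)
qed

lemma stretch_eq:
  "stretch a p q z = of_real (diag_form 1 1 z powr (a / 2) * diag_form p q z powr (- 1 / 2)) * Complex (p * Re z) (q * Im z)"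
  by (simp add: stretch_def weighted_def)

lemma norm_Complex_diag_form: "cmod (Complex (p * Re z) (q * Im z)) = diag_form p q z powr (1 / 2)"
  by (simp add: diag_form_def cmod_def powr_half_sqrt)

lemma norm_stretch:
  assumes "p > 0" "q > 0"
  shows "cmod (stretch a p q z) = cmod z powr a"
proof (cases "z = 0")
  case True
  then show ?thesis by (simp add: stretch_eq diag_form_def)
next
  case False
  then have pos: "diag_form p q z > 0" "diag_form 1 1 z > 0" using assms diag_form_pos by auto
  have "cmod z = diag_form 1 1 z powr (1 / 2)"
    using norm_Complex_diag_form[of 1 z 1] by simp
  then have "cmod z powr a = diag_form 1 1 z powr (a / 2)"
    by (simp add: powr_powr)
  moreover have "diag_form p q z powr (- 1 / 2) * diag_form p q z powr (1 / 2) = 1"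
    using pos by (simp flip: powr_add)
  ultimately show ?thesis
    unfolding stretch_eq norm_mult norm_Complex_diag_form norm_of_real by (simp add: abs_mult mult.assoc)
qed

text \<open>The condition \<open>p * r = q * s\<close> makes the composed axis scalings a positive
  multiple of the identity, so the ray through \<open>z\<close> is preserved;
  \<open>a * b = 1\<close> restores the modulus.\<close>

lemma stretch_stretch:
  assumes "p > 0" "q > 0" "r > 0" "s > 0" "p * r = q * s" "a * b = 1"
  shows "stretch b r s (stretch a p q z) = z"
proof (cases "z = 0")
  case True
  then show ?thesis by (simp add: stretch_eq diag_form_def)
next
  case False
  let ?w = "stretch a p q z"
  have w: "?w \<noteq> 0" using norm_stretch[OF assms(1,2), of a z] False by auto
  obtain t where t: "t > 0" "Complex (r * Re ?w) (s * Im ?w) = of_real t * z"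
  proof
    let ?c = "diag_form 1 1 z powr (a / 2) * diag_form p q z powr (- 1 / 2)"
    show "?c * (p * r) > 0"
      using assms diag_form_pos[of p q z] diag_form_pos[of 1 1 z] False by auto
    show "Complex (r * Re ?w) (s * Im ?w) = of_real (?c * (p * r)) * z"
      using assms(5) by (simp add: stretch_eq complex_eq_iff mult_ac)
  qed
  define u where "u = diag_form 1 1 ?w powr (b / 2) * diag_form r s ?w powr (- 1 / 2) * t"
  have u: "u > 0" "stretch b r s ?w = of_real u * z"
    using t diag_form_pos[of 1 1 ?w] diag_form_pos[of r s ?w] w assms
    by (simp_all add: u_def stretch_eq[of b r s ?w])
  have "cmod (stretch b r s ?w) = cmod z"
    using assms False by (simp add: norm_stretch powr_powr)
  then show ?thesis
    using u False by (simp add: norm_mult)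
qed

lemma stretch_in_half_plane: "p > 0 \<Longrightarrow> q > 0 \<Longrightarrow> z \<in> half_plane \<Longrightarrow> stretch a p q z \<in> half_plane"
  using diag_form_pos[of p q z] diag_form_pos[of 1 1 z]
  by (cases "z = 0") (auto simp: half_plane_def stretch_eq intro!: mult_pos_pos)

text \<open>The derivative of the angle of \<open>stretch a 1 a z\<close> with respect to the angle of \<open>z\<close>, and
  (\<open>angular'\<close> below) its second derivative.\<close>

definition angular :: "real \<Rightarrow> complex \<Rightarrow> real"
  where "angular a z = a * diag_form 1 1 z / diag_form 1 a z"

text \<open>Re (v / z) and Im (v / z) are the variations of the logarithm of the modulus and of the
  angle. In these coordinates the radial variable is scaled by \<open>a\<close> and the image angle
  depends on the angle alone, hence the diagonal form.\<close>

lemma has_derivative_stretch: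
  assumes a: "a > 0" and z: "z \<noteq> 0"
  shows "(stretch a 1 a has_derivative
    (\<lambda>v. stretch a 1 a z * Complex (a * Re (v / z)) (angular a z * Im (v / z)))) (at z)"
proof -
  have P: "((\<lambda>z. Complex (1 * Re z) (a * Im z)) has_derivative (\<lambda>v. Complex (Re v) (a * Im v))) (at z)"
    unfolding Complex_eq by (auto intro!: derivative_eq_intros)
  have pos: "diag_form 1 1 z > 0" "diag_form 1 a z > 0"
    using assms diag_form_pos by auto
  let ?w = "complex_of_real (diag_form 1 1 z powr (a / 2 - 1) * diag_form 1 a z powr (- 1 / 2 - 1))"
  have W: "complex_of_real (diag_form 1 1 z powr (a / 2) * diag_form 1 a z powr (- 1 / 2)) =
      ?w * of_real (diag_form 1 1 z * diag_form 1 a z)"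
    using powr_eq_mult[OF pos(1), of "a / 2"] powr_eq_mult[OF pos(2), of "- 1 / 2"] by simp
  have q1: "diag_form 1 1 z = (Re z)\<^sup>2 + (Im z)\<^sup>2" by (simp add: diag_form_def)
  have R: "Re (v / z) = (Re v * Re z + Im v * Im z) / diag_form 1 1 z"
    "Im (v / z) = (Im v * Re z - Re v * Im z) / diag_form 1 1 z" for v
    by (simp_all add: Re_divide Im_divide q1)
  have "(Complex (Re v) (a * Im v) * of_real (diag_form 1 1 z) * of_real (diag_form 1 a z)
          + Complex (1 * Re z) (a * Im z) * (of_real (a / 2) * of_real (diag_form_deriv 1 1 z v) * of_real (diag_form 1 a z)
                 + of_real (- 1 / 2) * of_real (diag_form_deriv 1 a z v) * of_real (diag_form 1 1 z))) =
     of_real (diag_form 1 1 z * diag_form 1 a z) * Complex (Re z) (a * Im z) *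
       Complex (a * Re (v / z)) (angular a z * Im (v / z))" for v
  proof -
    have "a * Re (v / z) = a * (Re v * Re z + Im v * Im z) * diag_form 1 a z / (diag_form 1 1 z * diag_form 1 a z)"
      "angular a z * Im (v / z) = a * (Im v * Re z - Re v * Im z) * diag_form 1 1 z / (diag_form 1 1 z * diag_form 1 a z)"
      unfolding angular_def R using pos by (simp_all add: field_simps)
    then have U: "Complex (a * (Re v * Re z + Im v * Im z) * diag_form 1 a z)
         (a * (Im v * Re z - Re v * Im z) * diag_form 1 1 z) =
       of_real (diag_form 1 1 z * diag_form 1 a z) * Complex (a * Re (v / z)) (angular a z * Im (v / z))"
      using pos by (simp add: complex_eq_iff)
    have d: "complex_of_real (a / 2) * of_real (diag_form_deriv 1 1 z v) = of_real (a * (Re z * Re v + Im z * Im v))"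
      "complex_of_real (- 1 / 2) * of_real (diag_form_deriv 1 a z v) = of_real (- Re z * Re v - a\<^sup>2 * Im z * Im v)"
      unfolding diag_form_deriv_def of_real_mult[symmetric] of_real_eq_iff by (simp_all add: field_simps)
    \<comment> \<open>With all denominators cleared, this is a polynomial identity in
      \<open>a\<close> and the coordinates of \<open>z\<close> and \<open>v\<close>.\<close>
    have "Complex (Re v) (a * Im v) * of_real (diag_form 1 1 z) * of_real (diag_form 1 a z)
          + Complex (1 * Re z) (a * Im z) * (of_real (a * (Re z * Re v + Im z * Im v)) * of_real (diag_form 1 a z)
                 + of_real (- Re z * Re v - a\<^sup>2 * Im z * Im v) * of_real (diag_form 1 1 z)) =
       Complex (Re z) (a * Im z) * Complex (a * (Re v * Re z + Im v * Im z) * diag_form 1 a z)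
         (a * (Im v * Re z - Re v * Im z) * diag_form 1 1 z)"
      unfolding diag_form_def complex_eq_iff by (simp add: power2_eq_square) algebra
    then show ?thesis
      unfolding d U by (simp only: mult_ac)
  qed
  then have "(weighted 1 a (a / 2) (- 1 / 2) (\<lambda>z. Complex (1 * Re z) (a * Im z)) has_derivative
     (\<lambda>v. of_real (diag_form 1 1 z * diag_form 1 a z) * Complex (Re z) (a * Im z) *
       Complex (a * Re (v / z)) (angular a z * Im (v / z)) * ?w)) (at z)"
    using has_derivative_weighted[OF _ a z P, where p = 1 and \<alpha> = "a / 2" and \<beta> = "- 1 / 2"]
    by simp
  then show ?thesis
    unfolding stretch_eq[of a 1 a z] W by (simp add: stretch_def mult_ac)
qed

definition angular' :: "real \<Rightarrow> complex \<Rightarrow> real"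
  where "angular' a z = - 2 * a * (a\<^sup>2 - 1) * Re z * Im z * diag_form 1 1 z / (diag_form 1 a z)\<^sup>2"

text \<open>\<open>angular a\<close> is homogeneous of degree 0, so only the variation of the angle,
  Im (v / z), enters its derivative.\<close>

lemma has_derivative_angular:
  assumes a: "a > 0" and z: "z \<noteq> 0"
  shows "(angular a has_derivative (\<lambda>v. angular' a z * Im (v / z))) (at z)"
proof -
  have pos: "diag_form 1 1 z > 0" "diag_form 1 a z > 0"
    using assms diag_form_pos by auto
  have R: "Im (v / z) = (Im v * Re z - Re v * Im z) / diag_form 1 1 z" for v
    by (simp add: Im_divide diag_form_def)
  have der: "((\<lambda>z. a * diag_form 1 1 z / diag_form 1 a z) has_derivative
    (\<lambda>v. a * (diag_form_deriv 1 1 z v * diag_form 1 a z - diag_form 1 1 z * diag_form_deriv 1 a z v) / (diag_form 1 a z)\<^sup>2)) (at z)"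
    using pos by (auto intro!: derivative_eq_intros simp: fun_eq_iff field_simps power2_eq_square)
  have num: "diag_form_deriv 1 1 z v * diag_form 1 a z - diag_form 1 1 z * diag_form_deriv 1 a z v =
     - 2 * (a\<^sup>2 - 1) * Re z * Im z * (Im v * Re z - Re v * Im z)" for v
    unfolding diag_form_def diag_form_deriv_def by (simp add: power2_eq_square algebra_simps)
  have "a * (- 2 * e * Re z * Im z * d) / (diag_form 1 a z)\<^sup>2 =
      - 2 * a * e * Re z * Im z * diag_form 1 1 z / (diag_form 1 a z)\<^sup>2 * (d / diag_form 1 1 z)" for d e
    using pos by (simp add: mult_ac)
  then have "a * (diag_form_deriv 1 1 z v * diag_form 1 a z - diag_form 1 1 z * diag_form_deriv 1 a z v) / (diag_form 1 a z)\<^sup>2 =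
      angular' a z * Im (v / z)" for v
    unfolding angular'_def R num .
  then show ?thesis
    using der unfolding angular_def[abs_def] by simp
qed


lemma dff_stretch:
  assumes "a > 0" "z \<noteq> 0"
  shows "dff (stretch a 1 a) z v =
    stretch a 1 a z * Complex (a * Re (v / z)) (angular a z * Im (v / z))"
  using frechet_derivative_at[OF has_derivative_stretch[OF assms]] by metis

lemma half_plane_nonzero: "z \<in> half_plane \<Longrightarrow> z \<noteq> 0"
  by (auto simp: half_plane_def)

lemma angular_pos: "a > 0 \<Longrightarrow> z \<noteq> 0 \<Longrightarrow> angular a z > 0"
  using diag_form_pos[of 1 1 z] diag_form_pos[of 1 a z] by (simp add: angular_def)

lemma bij_betw_stretch:
  assumes "a > 0"
  shows "bij_betw (stretch a 1 a) half_plane half_plane"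
  using assms
  by (intro bij_betw_byWitness[where f' = "stretch (1 / a) a 1"])
    (auto simp: stretch_stretch stretch_in_half_plane)

section \<open>Area, dilatation and boundary values\<close>

lemma oriented_area_mult:
  "oriented_area (c * v) (c * w) = (cmod c)\<^sup>2 * oriented_area v w"
  unfolding oriented_area_def cmod_power2 by (simp add: power2_eq_square algebra_simps)

lemma oriented_area_dff_stretch:
  assumes "a > 0" "z \<noteq> 0"
  shows "oriented_area (dff (stretch a 1 a) z v) (dff (stretch a 1 a) z w) =
    (cmod (stretch a 1 a z))\<^sup>2 * (a * angular a z / (cmod z)\<^sup>2) * oriented_area v w"
proof -
  have "oriented_area (dff (stretch a 1 a) z v) (dff (stretch a 1 a) z w) =
     (cmod (stretch a 1 a z))\<^sup>2 * (a * angular a z) * oriented_area (v / z) (w / z)"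
    unfolding dff_stretch[OF assms] oriented_area_mult
    by (simp add: oriented_area_def algebra_simps)
  moreover have "oriented_area v w = (cmod z)\<^sup>2 * oriented_area (v / z) (w / z)"
    using oriented_area_mult[of z "v / z" "w / z"] assms by simp
  ultimately show ?thesis
    using assms by simp
qed

lemma op_diffeo_stretch:
  assumes a: "a > 0"
  shows "op_diffeo (stretch a 1 a)"
  unfolding op_diffeo_def
proof (intro conjI ballI)
  \<comment> \<open>The equality is available only on the half-plane; \<open>Ck_on_cong\<close>
    transfers smoothness from the explicit inverse because the half-plane is open.\<close>
  have "inv_into half_plane (stretch a 1 a) w = stretch (1 / a) a 1 w" if "w \<in> half_plane" for w
  proof (rule inv_into_f_eq)
    show "inj_on (stretch a 1 a) half_plane"
      using bij_betw_stretch[OF a] by (rule bij_betw_imp_inj_on)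
    show "stretch a 1 a (stretch (1 / a) a 1 w) = w"
      using a by (simp add: stretch_stretch)
  qed (use a that in \<open>simp add: stretch_in_half_plane\<close>)
  then show "smooth_on half_plane (inv_into half_plane (stretch a 1 a))"
    using smooth_on_stretch[OF a zero_less_one, of "1 / a"] unfolding smooth_on_def
    by (metis Ck_on_cong open_half_plane)
next
  fix z assume "z \<in> half_plane"
  then have z: "z \<noteq> 0" by (rule half_plane_nonzero)
  then have "stretch a 1 a z \<noteq> 0"
    using norm_stretch[OF zero_less_one a, of a z] by auto
  then show "oriented_area (dff (stretch a 1 a) z 1) (dff (stretch a 1 a) z \<i>) > 0"
    unfolding oriented_area_dff_stretch[OF a z] using angular_pos[OF a z] a z
    by (simp add: oriented_area_def)
qed (use a in \<open>auto intro: bij_betw_stretch smooth_on_stretch\<close>)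

lemma Im_Re_stretch:
  "Im (stretch a 1 a z) = diag_form 1 1 z powr (a / 2) * diag_form 1 a z powr (- 1 / 2) * (a * Im z)"
  "Re (stretch a 1 a z) = diag_form 1 1 z powr (a / 2) * diag_form 1 a z powr (- 1 / 2) * Re z"
  by (simp_all add: stretch_eq)

text \<open>The positive scalar prefactor cancels in the quotient. This is the hyperbolic square
  length of the frame vector \<open>stretch a 1 a z\<close> at the image point, used for the area
  form and again for minimality.\<close>

lemma norm_over_Im_stretch:
  assumes a: "a > 0" and z: "z \<in> half_plane"
  shows "(cmod (stretch a 1 a z))\<^sup>2 / (Im (stretch a 1 a z))\<^sup>2 = diag_form 1 a z / (a * Im z)\<^sup>2"
proof -
  define k where "k = diag_form 1 1 z powr (a / 2) * diag_form 1 a z powr (- 1 / 2)"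
  have "k > 0"
    using diag_form_pos[of 1 1 z] diag_form_pos[of 1 a z] half_plane_nonzero[OF z] a by (simp add: k_def)
  moreover have "(cmod (stretch a 1 a z))\<^sup>2 = k\<^sup>2 * diag_form 1 a z"
    unfolding cmod_power2 Im_Re_stretch k_def[symmetric] by (simp add: diag_form_def power_mult_distrib algebra_simps)
  ultimately show ?thesis
    unfolding Im_Re_stretch k_def[symmetric] by (simp add: power_mult_distrib)
qed

lemma norm_sq_diag_form: "(cmod z)\<^sup>2 = diag_form 1 1 z"
  by (simp add: diag_form_def cmod_power2)

text \<open>The Jacobian in the frames is \<open>a * angular a z\<close>; the two quadratic forms in
  \<open>angular\<close> cancel against the square lengths of the frame vectors.\<close>

lemma area_preserving_stretch:
  assumes a: "a > 0"
  shows "area_preserving (stretch a 1 a)"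
  unfolding area_preserving_def
proof (intro ballI allI)
  fix z v w assume z: "z \<in> half_plane"
  have nz: "z \<noteq> 0" "Im z > 0" and pos: "diag_form 1 1 z > 0" "diag_form 1 a z > 0"
    using half_plane_nonzero[OF z] z a diag_form_pos by (auto simp: half_plane_def)
  have "oriented_area (dff (stretch a 1 a) z v) (dff (stretch a 1 a) z w) / (Im (stretch a 1 a z))\<^sup>2 =
    ((cmod (stretch a 1 a z))\<^sup>2 / (Im (stretch a 1 a z))\<^sup>2) * (a * angular a z / (cmod z)\<^sup>2) * oriented_area v w"
    unfolding oriented_area_dff_stretch[OF a nz(1)] by simp
  also have "\<dots> = oriented_area v w / (Im z)\<^sup>2"
    unfolding norm_over_Im_stretch[OF a z] angular_def norm_sq_diag_form[of z] using pos nz a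
    by (simp add: power_mult_distrib power2_eq_square)
  finally show "oriented_area (dff (stretch a 1 a) z v) (dff (stretch a 1 a) z w)
    / (Im (stretch a 1 a z))\<^sup>2 = oriented_area v w / (Im z)\<^sup>2" .
qed

section \<open>Bounds for the dilatation\<close>

lemma dilatation_at_bounds:
  assumes m: "m > 0" and bounds: "\<And>v. cmod v = 1 \<Longrightarrow> m \<le> cmod (dff f z v) \<and> cmod (dff f z v) \<le> M"
  shows "dilatation_at f z > 0" "dilatation_at f z \<le> M / m"
proof -
  let ?N = "\<lambda>v. cmod (dff f z v)"
  have ne: "sphere (0::complex) 1 \<noteq> {}" by (simp add: sphere_eq_empty)
  have 1: "m \<le> ?N 1" using bounds by simp
  have "bdd_above (?N ` sphere 0 1)"
    using bounds by (intro bdd_aboveI2[where M = M]) auto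
  then have "?N 1 \<le> (SUP v\<in>sphere 0 1. ?N v)"
    by (intro cSUP_upper) auto
  with 1 have S: "m \<le> (SUP v\<in>sphere 0 1. ?N v)" by simp
  have S': "(SUP v\<in>sphere 0 1. ?N v) \<le> M"
    using bounds ne by (intro cSUP_least) auto
  have I: "m \<le> (INF v\<in>sphere 0 1. ?N v)"
    using bounds ne by (intro cINF_greatest) auto
  show "dilatation_at f z > 0"
    unfolding dilatation_at_def using S I m by (intro divide_pos_pos) linarith+
  show "dilatation_at f z \<le> M / m"
    unfolding dilatation_at_def using S S' I m by (intro frac_le) linarith+
qed

lemma angular_bounds:
  assumes "a \<ge> 1" "z \<noteq> 0"
  shows "1 / a \<le> angular a z" "angular a z \<le> a"
proof -
  have "1 \<le> a\<^sup>2" using assms by simp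
  then have "(Im z)\<^sup>2 \<le> a\<^sup>2 * (Im z)\<^sup>2" "(Re z)\<^sup>2 \<le> a\<^sup>2 * (Re z)\<^sup>2"
    by (simp_all add: mult_left_le_one_le mult_le_cancel_right1)
  then have "diag_form 1 1 z \<le> diag_form 1 a z" "diag_form 1 a z \<le> a\<^sup>2 * diag_form 1 1 z"
    by (simp_all add: diag_form_def algebra_simps)
  moreover have "diag_form 1 a z > 0" using assms diag_form_pos by simp
  ultimately show "1 / a \<le> angular a z" "angular a z \<le> a"
    using assms by (auto simp: angular_def divide_simps power2_eq_square mult_ac)
qed

text \<open>Up to the conformal factor \<open>c\<close> coming from the frames, the differential is
  diagonal with entries \<open>a\<close> and \<open>angular a z\<close>, both in the interval from
  \<open>1 / a\<close> to \<open>a\<close>.\<close>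

lemma dilatation_stretch:
  assumes a: "a \<ge> 1" and z: "z \<noteq> 0"
  shows "dilatation_at (stretch a 1 a) z > 0" "dilatation_at (stretch a 1 a) z \<le> a\<^sup>2"
proof -
  let ?f = "stretch a 1 a" and ?G = "angular a z"
  define c where "c = cmod (?f z) / cmod z"
  have a0: "a > 0" using a by simp
  have "?f z \<noteq> 0"
    using norm_stretch[OF zero_less_one a0, of a z] z by auto
  then have c: "c > 0" using z by (simp add: c_def)
  have "c * (1 / a) \<le> cmod (dff ?f z v)" "cmod (dff ?f z v) \<le> c * a" if "cmod v = 1" for v
  proof -
    have G: "1 / a \<le> ?G" "?G \<le> a" "0 \<le> 1 / a" "1 / a \<le> a"
      using angular_bounds[OF a z] a order.trans by auto
    have sq: "(1 / a)\<^sup>2 \<le> ?G\<^sup>2" "?G\<^sup>2 \<le> a\<^sup>2" "(1 / a)\<^sup>2 \<le> a\<^sup>2"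
      using G angular_pos[OF a0 z] by (auto intro!: power_mono)
    let ?u = "v / z"
    let ?w = "Complex (a * Re ?u) (?G * Im ?u)"
    have w: "(cmod ?w)\<^sup>2 = a\<^sup>2 * (Re ?u)\<^sup>2 + ?G\<^sup>2 * (Im ?u)\<^sup>2"
      by (simp add: cmod_power2 power_mult_distrib)
    have "(cmod ?w)\<^sup>2 \<le> a\<^sup>2 * (Re ?u)\<^sup>2 + a\<^sup>2 * (Im ?u)\<^sup>2"
      unfolding w using sq by (intro add_mono mult_right_mono) auto
    also have "\<dots> = (a * cmod ?u)\<^sup>2"
      by (simp add: cmod_power2 power_mult_distrib algebra_simps)
    finally have up: "cmod ?w \<le> a * cmod ?u"
      by (rule power2_le_imp_le) (use a0 in simp)
    have "(1 / a * cmod ?u)\<^sup>2 = (1 / a)\<^sup>2 * (Re ?u)\<^sup>2 + (1 / a)\<^sup>2 * (Im ?u)\<^sup>2"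
      unfolding power_mult_distrib cmod_power2 distrib_left ..
    also have "\<dots> \<le> (cmod ?w)\<^sup>2"
      unfolding w using sq by (intro add_mono mult_right_mono) auto
    finally have lo: "1 / a * cmod ?u \<le> cmod ?w"
      by (rule power2_le_imp_le) simp
    have "cmod (dff ?f z v) = cmod (?f z) * cmod ?w"
      unfolding dff_stretch[OF a0 z] norm_mult ..
    moreover have "cmod ?u = 1 / cmod z" using that by (simp add: norm_divide)
    ultimately show "c * (1 / a) \<le> cmod (dff ?f z v)" "cmod (dff ?f z v) \<le> c * a"
      using mult_left_mono[OF up norm_ge_zero, of "?f z"] mult_left_mono[OF lo norm_ge_zero, of "?f z"]
      by (simp_all add: c_def mult_ac)
  qed
  moreover have "c * (1 / a) > 0" using c a0 by simp
  moreover have "(c * a) / (c * (1 / a)) = a\<^sup>2"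
    using c a0 by (simp add: power2_eq_square)
  ultimately show "dilatation_at ?f z > 0" "dilatation_at ?f z \<le> a\<^sup>2"
    using dilatation_at_bounds[of "c * (1 / a)" ?f z "c * a"] by auto
qed

lemma log_max_dilatation_stretch:
  assumes "a \<ge> 1"
  shows "log_ereal (max_dilatation (stretch a 1 a)) \<le> ereal (2 * ln a)"
proof -
  let ?K = "max_dilatation (stretch a 1 a)"
  have "?K \<le> ereal (a\<^sup>2)"
    unfolding max_dilatation_def
    using dilatation_stretch(2)[OF assms half_plane_nonzero] by (intro SUP_least) auto
  moreover have "ereal (dilatation_at (stretch a 1 a) \<i>) \<le> ?K"
    unfolding max_dilatation_def by (intro SUP_upper) (simp add: half_plane_def)
  moreover have "0 < ereal (dilatation_at (stretch a 1 a) \<i>)"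
    using dilatation_stretch(1)[OF assms, of \<i>] by simp
  \<comment> \<open>Finiteness selects the real branch of \<open>log_ereal\<close>; positivity, seen
    at the point \<open>\<i>\<close>, makes the logarithm monotone there.\<close>
  ultimately obtain k where k: "?K = ereal k" "0 < k" "k \<le> a\<^sup>2"
    by (cases ?K) auto
  have "ln k \<le> ln (a\<^sup>2)"
    using k assms by (intro iffD2[OF ln_le_cancel_iff]) auto
  also have "\<dots> = 2 * ln a"
    using assms by (simp add: ln_realpow)
  finally show ?thesis
    by (simp add: log_ereal_def k(1))
qed

section \<open>Boundary values\<close>

text \<open>On the real axis both quadratic forms equal the square of \<open>x\<close>, leaving the
  n-th power of \<bar>x\<bar> times the sign of \<open>x\<close>; this is \<open>x ^ n\<close> for
  odd \<open>n\<close>.\<close>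

lemma stretch_of_real:
  assumes "odd n"
  shows "stretch (real n) 1 (real n) (of_real x) = of_real (x ^ n)"
proof (cases "x = 0")
  case True
  then show ?thesis using odd_pos[OF assms] by (simp add: stretch_eq diag_form_def)
next
  case False
  obtain m where m: "n = Suc m" "even m"
    using assms by (metis even_Suc odd_pos gr0_implies_Suc)
  have "x\<^sup>2 = \<bar>x\<bar> powr 2" using False by simp
  then have "x\<^sup>2 powr (real n / 2) = \<bar>x\<bar> ^ n" "x\<^sup>2 powr (- 1 / 2) = 1 / \<bar>x\<bar>"
    using False
    by (simp_all only: powr_powr) (simp_all add: powr_realpow powr_minus_divide)
  then have "stretch (real n) 1 (real n) (of_real x) = of_real (\<bar>x\<bar> ^ n * (1 / \<bar>x\<bar>) * x)"
    by (simp add: stretch_eq diag_form_def complex_eq_iff)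
  also have "\<bar>x\<bar> ^ n * (1 / \<bar>x\<bar>) * x = x ^ n"
    using False m by (simp add: power_even_abs)
  finally show ?thesis .
qed

lemma continuous_stretch:
  assumes a: "a > 0"
  shows "continuous (at z) (stretch a 1 a)"
proof (cases "z = 0")
  case True
  have "((\<lambda>z. cmod z powr a) \<longlongrightarrow> 0) (at 0)"
    by (rule tendsto_zero_powrI[OF tendsto_norm_zero[OF tendsto_ident_at] tendsto_const _ a]) simp
  then have "(stretch a 1 a \<longlongrightarrow> 0) (at 0)"
    by (rule_tac tendsto_norm_zero_cancel) (simp add: norm_stretch[OF zero_less_one a])
  moreover have "stretch a 1 a 0 = 0" by (simp add: stretch_eq diag_form_def)
  ultimately show ?thesis
    using True by (simp add: continuous_at)
next
  case False
  then show ?thesis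
    using has_derivative_continuous[OF has_derivative_stretch[OF a]] by blast
qed

text \<open>The formula for the stretch map makes sense on the closed half-plane and already has the
  right values on the real axis, so the glued map is its \<open>map_option\<close>. Properness
  follows from \<open>norm_stretch\<close>.\<close>

lemma extends_continuously_stretch:
  assumes n: "odd n"
  shows "extends_continuously (stretch (real n) 1 (real n)) (map_option (\<lambda>x. x ^ n))"
proof -
  let ?f = "stretch (real n) 1 (real n)" and ?S = "{z. Im z \<ge> 0}"
  have n0: "real n > 0" using odd_pos[OF n] by simp
  have real: "?f z = of_real (Re z ^ n)" if "Im z = 0" for z
  proof -
    have "of_real (Re z) = z" using that by (simp add: complex_eq_iff)
    with stretch_of_real[OF n, of "Re z"] show ?thesis by simp
  qed
  have "continuous_map closed_disc closed_disc (map_option ?f)"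
    unfolding closed_disc_def
  proof (rule continuous_map_Alexandroff_closed_subset)
    show "continuous_on ?S ?f"
      using continuous_stretch[OF n0] by (intro continuous_at_imp_continuous_on) auto
    have "Im (?f z) \<ge> 0" if "Im z \<ge> 0" for z
      using that n0 by (simp add: Im_Re_stretch)
    then show "?f ` ?S \<subseteq> ?S" by auto
    show "closed ?S" by (simp add: closed_halfspace_Im_ge)
    fix B :: "complex set" assume "bounded B"
    then obtain b where b: "\<And>w. w \<in> B \<Longrightarrow> cmod w \<le> b"
      by (auto simp: bounded_iff)
    have "cmod z \<le> b powr (1 / real n)" if "?f z \<in> B" for z
    proof -
      have "cmod z powr real n \<le> b"
        using b[OF that] n0 by (simp add: norm_stretch)
      then have "(cmod z powr real n) powr (1 / real n) \<le> b powr (1 / real n)"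
        by (intro powr_mono2) auto
      then show ?thesis
        using n0 by (simp add: powr_powr)
    qed
    then show "bounded {z \<in> ?S. ?f z \<in> B}"
      by (auto simp: bounded_iff)
  qed
  moreover have "map_option ?f p = glue_boundary ?f (map_option (\<lambda>x. x ^ n)) p"
    if "p \<in> topspace closed_disc" for p
    using that real by (auto simp: closed_disc_def glue_boundary_def half_plane_def)
  ultimately show ?thesis
    unfolding extends_continuously_def by (rule continuous_map_eq)
qed

text \<open>Logarithmic against linear growth. The choice \<open>n = 2 * N + 3\<close> is odd and
  large enough for \<open>n / 2\<close> to be at most \<open>n - 1\<close>; the argument
  \<open>2 ^ n - 1\<close> is then replaced by the smaller \<open>2 ^ (n - 1)\<close>.\<close>

lemma exists_odd_ln_less:
  fixes C :: real
  assumes "C > 0"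
  shows "\<exists>n. odd n \<and> 2 * ln (real n) < C * ln (2 ^ n - 1)"
proof -
  have "C * ln 2 / 4 > 0" using assms by simp
  then have "\<forall>\<^sub>F n in sequentially. ln (real n) / real n < C * ln 2 / 4"
    using lim_ln_over_n order_tendstoD(2) by blast
  then obtain N where N: "\<And>n. n \<ge> N \<Longrightarrow> ln (real n) / real n < C * ln 2 / 4"
    by (auto simp: eventually_sequentially)
  define n where "n = 2 * N + 3"
  have n: "n \<ge> N" "odd n" "real n \<ge> 3" by (auto simp: n_def)
  have "2 * ln (real n) < C * ln 2 * (real n / 2)"
    using N[OF n(1)] n(3) by (simp add: field_simps)
  also have "\<dots> \<le> C * ln 2 * real (n - 1)"
    using n(3) assms by (intro mult_left_mono) (auto simp: n_def)
  also have "\<dots> = C * ln (2 ^ (n - 1))"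
    by (simp add: ln_realpow)
  also have "\<dots> \<le> C * ln (2 ^ n - 1)"
  proof -
    have "(2::real) ^ n = 2 * 2 ^ (n - 1)" "(1::real) \<le> 2 ^ (n - 1)"
      using n(3) by (cases n) auto
    then have "(2::real) ^ (n - 1) \<le> 2 ^ n - 1" by linarith
    then show ?thesis
      using assms by (intro mult_left_mono) (auto intro!: ln_mono)
  qed
  finally show ?thesis using n(2) by blast
qed


section \<open>Minimality\<close>

text \<open>The product rule applied to \<open>dff_stretch\<close> with \<open>w\<close> fixed: the
  first product comes from the outer factor, and the derivative of w / z contributes the minus
  signs.\<close>

lemma has_derivative_dff_stretch:
  assumes a: "a > 0" and z: "z \<noteq> 0"
  shows "((\<lambda>\<zeta>. dff (stretch a 1 a) \<zeta> w) has_derivative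
    (\<lambda>v. stretch a 1 a z *
      (Complex (a * Re (v / z)) (angular a z * Im (v / z)) *
       Complex (a * Re (w / z)) (angular a z * Im (w / z)) +
       Complex (- a * Re (v / z * (w / z)))
         (angular' a z * Im (v / z) * Im (w / z) - angular a z * Im (v / z * (w / z)))))) (at z)"
    (is "(_ has_derivative ?D) _")
proof -
  have q: "((\<lambda>\<zeta>. w / \<zeta>) has_derivative (\<lambda>v. - (v / z * (w / z)))) (at z)"
    using z by (auto intro!: derivative_eq_intros simp: fun_eq_iff field_simps)
  have "((\<lambda>\<zeta>. Complex (a * Re (w / \<zeta>)) (angular a \<zeta> * Im (w / \<zeta>))) has_derivative
      (\<lambda>v. of_real (a * Re (- (v / z * (w / z)))) +
        \<i> * of_real (angular a z * Im (- (v / z * (w / z))) + angular' a z * Im (v / z) * Im (w / z))))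
      (at z)"
    unfolding Complex_eq
    by (intro has_derivative_add has_derivative_mult_right has_derivative_of_real
        has_derivative_mult has_derivative_angular[OF a z]
        bounded_linear.has_derivative[OF bounded_linear_Re q]
        bounded_linear.has_derivative[OF bounded_linear_Im q])
  from has_derivative_mult[OF has_derivative_stretch[OF a z] this]
  have "((\<lambda>\<zeta>. stretch a 1 a \<zeta> * Complex (a * Re (w / \<zeta>)) (angular a \<zeta> * Im (w / \<zeta>)))
      has_derivative ?D) (at z)"
    by (rule has_derivative_eq_rhs) (simp add: fun_eq_iff Complex_eq algebra_simps)
  then show ?thesis
    by (rule has_derivative_transform_within_open[where s = "- {0}"])
      (use a z in \<open>auto simp: dff_stretch\<close>)
qed

lemma inner_mult_complex: "(c * u) \<bullet> (c * w) = (cmod c)\<^sup>2 * (u \<bullet> w)" for c u w :: complex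
  unfolding inner_complex_def cmod_power2 by (simp add: power2_eq_square algebra_simps)

lemma dff_ident: "dff (\<lambda>z. z) z v = v"
  using frechet_derivative_at[OF has_derivative_ident[of "at z"]] by metis

lemma cov_deriv_ident:
  assumes "z \<noteq> 0"
  shows "cov_deriv (\<lambda>z. z) z v w = z * (\<i> * (z / Im z) * (v / z) * (w / z))"
  using assms by (simp add: cov_deriv_def dff_ident christoffel_def frechet_derivative_const)

text \<open>Factoring out the image point expresses the covariant derivative in its frame. The
  factor with real part \<open>Re z / (a * Im z)\<close> is the image point divided by its height,
  that is, the cotangent of the image angle plus \<i>.\<close>

lemma cov_deriv_stretch:
  assumes a: "a > 0" and z: "z \<in> half_plane"
  defines "U \<equiv> \<lambda>v. Complex (a * Re (v / z)) (angular a z * Im (v / z))"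
  shows "cov_deriv (stretch a 1 a) z v w = stretch a 1 a z *
      (U v * U w +
       Complex (- a * Re (v / z * (w / z)))
         (angular' a z * Im (v / z) * Im (w / z) - angular a z * Im (v / z * (w / z))) +
       \<i> * Complex (Re z / (a * Im z)) 1 * U v * U w)"
proof -
  have nz: "z \<noteq> 0" "Im z > 0" using z half_plane_nonzero by (auto simp: half_plane_def)
  let ?f = "stretch a 1 a z"
  define k where "k = diag_form 1 1 z powr (a / 2) * diag_form 1 a z powr (- 1 / 2)"
  have "diag_form 1 1 z > 0" "diag_form 1 a z > 0"
    using nz a by (simp_all add: diag_form_pos)
  then have k: "k > 0" by (simp add: k_def)
  have ReIm: "Re ?f = k * Re z" "Im ?f = k * (a * Im z)"
    unfolding Im_Re_stretch k_def by (rule refl)+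
  have f: "?f / Im ?f = Complex (Re z / (a * Im z)) 1"
    using k nz a by (simp add: complex_eq_iff ReIm)
  have "christoffel ?f (?f * U v) (?f * U w) = ?f * (\<i> * (?f / Im ?f) * U v * U w)"
    by (simp add: christoffel_def)
  then show ?thesis
    unfolding cov_deriv_def dff_stretch[OF a nz(1)] f
      frechet_derivative_at[OF has_derivative_dff_stretch[OF a nz(1)], symmetric]
    by (simp add: U_def distrib_left)
qed

text \<open>
  The numerator of the mean curvature is, up to the square of the change of basis, independent of
  the basis; it is evaluated in a basis dual to \<open>\<alpha>, \<beta>\<close>, which diagonalizes \<open>A\<close>.
\<close>

lemma trace_numerator_eq_0:
  fixes E F L M N :: real
  assumes "E * N + F * L = 0"
    and "\<And>v w. A v w = E * (\<alpha> v * \<alpha> w) + F * (\<beta> v * \<beta> w)"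
    and "\<And>v w. B v w = L * (\<alpha> v * \<alpha> w) + M * (\<alpha> v * \<beta> w + \<beta> v * \<alpha> w) + N * (\<beta> v * \<beta> w)"
  shows "A j j * B i i - 2 * A i j * B i j + A i i * B j j = 0"
proof -
  have "A j j * B i i - 2 * A i j * B i j + A i i * B j j =
    (E * N + F * L) * (\<alpha> i * \<beta> j - \<alpha> j * \<beta> i)\<^sup>2"
    unfolding assms(2,3) by (simp add: power2_eq_square algebra_simps)
  then show ?thesis using assms(1) by simp
qed

text \<open>Stated with free parameters so that the coefficients of the second fundamental form can
  be read off without unfolding any geometric quantity.\<close>

lemma quadratic_form_expand:
  fixes V W \<mu> \<nu> :: complex
  shows "c * ((\<i> * Complex p 1 * V * W) \<bullet> \<mu>) +
      K * ((Complex (a * Re V) (G * Im V) * Complex (a * Re W) (G * Im W) +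
         Complex (- a * Re (V * W)) (g * Im V * Im W - G * Im (V * W)) +
         \<i> * Complex e 1 * Complex (a * Re V) (G * Im V) * Complex (a * Re W) (G * Im W)) \<bullet> \<nu>) =
    c * ((- Re \<mu> + p * Im \<mu>) * (Re V * Re W - Im V * Im W)
         - (p * Re \<mu> + Im \<mu>) * (Re V * Im W + Im V * Re W)) +
       K * (Re \<nu> * (- a * (Re V * Re W - Im V * Im W)
            - e * (a * G) * (Re V * Im W + Im V * Re W)) +
           Im \<nu> * (g * (Im V * Im W) - G * (Re V * Im W + Im V * Re W)
             + e * (a\<^sup>2 * (Re V * Re W) - G\<^sup>2 * (Im V * Im W))))"
  unfolding inner_complex_def by (simp add: power2_eq_square; simp add: algebra_simps)

text \<open>In the frame z, \<i> z the first fundamental form is diagonal. Normality eliminates the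
  component \<open>\<mu>\<close> of the normal vector, and the vanishing trace becomes a relation
  between the angle derivative \<open>G\<close> and its own derivative \<open>g\<close>.\<close>

lemma minimal_surface_stretch:
  assumes a: "a > 0"
  shows "minimal_surface (\<lambda>z. z) (stretch a 1 a)"
  unfolding minimal_surface_def
proof (intro ballI allI impI)
  fix z N
  assume z: "z \<in> half_plane" and N: "normal_to (\<lambda>z. z) (stretch a 1 a) z N"
  let ?f = "stretch a 1 a"
  define G where "G = angular a z"
  define g where "g = angular' a z"
  define x where "x = Re z"
  define y where "y = Im z"
  define p where "p = x / y"
  define r where "r = x\<^sup>2 + y\<^sup>2"
  define R where "R = x\<^sup>2 + a\<^sup>2 * y\<^sup>2"
  \<comment> \<open>\<open>c\<close> and \<open>K\<close> are the hyperbolic square lengths of z and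
    of its image, as vectors at those points; in the frames each metric is this constant times the
    Euclidean inner product.\<close>
  define c where "c = r / y\<^sup>2"
  define K where "K = R / (a * y)\<^sup>2"
  define \<mu> where "\<mu> = fst N / z"
  define \<nu> where "\<nu> = snd N / ?f z"
  define U where "U = (\<lambda>v. Complex (a * Re (v / z)) (G * Im (v / z)))"
  have nz: "z \<noteq> 0" and y: "y > 0"
    using z half_plane_nonzero by (auto simp: half_plane_def y_def)
  have rR: "diag_form 1 1 z = r" "diag_form 1 a z = R"
    by (simp_all add: diag_form_def r_def R_def x_def y_def power_mult_distrib)
  have pos: "r > 0" "R > 0"
    using diag_form_pos[of 1 1 z] diag_form_pos[of 1 a z] nz a by (simp_all add: rR)
  have fz: "?f z \<noteq> 0"
    using norm_stretch[OF zero_less_one a, of a z] nz by auto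
  have hz: "hyp_inner z (z * u) (z * w) = c * (u \<bullet> w)" for u w
    by (simp add: hyp_inner_def inner_mult_complex c_def norm_sq_diag_form rR y_def)
  have hf: "hyp_inner (?f z) (?f z * u) (?f z * w) = K * (u \<bullet> w)" for u w
  proof -
    have "K = (cmod (?f z))\<^sup>2 / (Im (?f z))\<^sup>2"
      unfolding norm_over_Im_stretch[OF a z] K_def rR y_def ..
    then show ?thesis
      by (simp add: hyp_inner_def inner_mult_complex)
  qed
  have Neq: "fst N = z * \<mu>" "snd N = ?f z * \<nu>"
    using nz fz by (simp_all add: \<mu>_def \<nu>_def)
  have df: "dff ?f z v = ?f z * U v" for v
    unfolding dff_stretch[OF a nz] U_def G_def ..
  have vz: "z * (v / z) = v" for v
    using nz by simp
  have normal: "c * ((v / z) \<bullet> \<mu>) + K * (U v \<bullet> \<nu>) = 0" for v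
    using N[unfolded normal_to_def, rule_format, of v] hz[of "v / z" \<mu>] hf[of "U v" \<nu>]
    unfolding dff_ident df Neq vz by simp
  \<comment> \<open>Testing normality on the frame vectors z and \<i> z separates real and imaginary
    parts.\<close>
  have n1: "c * Re \<mu> = - K * a * Re \<nu>"
    using normal[of z] nz by (simp add: U_def inner_complex_def)
  have n2: "c * Im \<mu> = - K * G * Im \<nu>"
    using normal[of "\<i> * z"] nz by (simp add: U_def inner_complex_def)
  define L where "L = c * (- Re \<mu> + p * Im \<mu>) + K * (- a * Re \<nu> + a * p * Im \<nu>)"
  define M where "M = c * (- p * Re \<mu> - Im \<mu>) + K * (- p * G * Re \<nu> - G * Im \<nu>)"
  define Q where "Q = c * (Re \<mu> - p * Im \<mu>) + K * (a * Re \<nu> + (g - p * G\<^sup>2 / a) * Im \<nu>)"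
  have I: "first_ff (\<lambda>z. z) ?f z v w = (c + K * a\<^sup>2) * (Re (v / z) * Re (w / z)) +
      (c + K * G\<^sup>2) * (Im (v / z) * Im (w / z))" for v w
    using hz[of "v / z" "w / z"] hf[of "U v" "U w"]
    unfolding first_ff_def dff_ident df vz
    by (simp add: U_def inner_complex_def power2_eq_square algebra_simps)
  have II: "second_ff (\<lambda>z. z) ?f z N v w = L * (Re (v / z) * Re (w / z)) +
     M * (Re (v / z) * Im (w / z) + Im (v / z) * Re (w / z)) + Q * (Im (v / z) * Im (w / z))" for v w
  proof -
    have "z / Im z = Complex p 1"
      using y by (simp add: complex_eq_iff p_def x_def y_def)
    then have C1: "cov_deriv (\<lambda>z. z) z v w = z * (\<i> * Complex p 1 * (v / z) * (w / z))"
      using cov_deriv_ident[OF nz, of v w] by simp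
    have C2: "cov_deriv ?f z v w = ?f z *
      (U v * U w + Complex (- a * Re (v / z * (w / z)))
         (g * Im (v / z) * Im (w / z) - G * Im (v / z * (w / z))) +
       \<i> * Complex (p / a) 1 * U v * U w)"
      unfolding cov_deriv_stretch[OF a z] U_def G_def g_def p_def x_def y_def by (simp add: mult.commute)
    have "second_ff (\<lambda>z. z) ?f z N v w =
        c * ((\<i> * Complex p 1 * (v / z) * (w / z)) \<bullet> \<mu>) +
        K * ((U v * U w + Complex (- a * Re (v / z * (w / z)))
         (g * Im (v / z) * Im (w / z) - G * Im (v / z * (w / z))) +
       \<i> * Complex (p / a) 1 * U v * U w) \<bullet> \<nu>)"
      unfolding second_ff_def C1 C2 Neq hz hf ..
    also have "\<dots> = c * ((- Re \<mu> + p * Im \<mu>) * (Re (v / z) * Re (w / z) - Im (v / z) * Im (w / z))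
         - (p * Re \<mu> + Im \<mu>) * (Re (v / z) * Im (w / z) + Im (v / z) * Re (w / z))) +
       K * (Re \<nu> * (- a * (Re (v / z) * Re (w / z) - Im (v / z) * Im (w / z))
            - (p / a) * (a * G) * (Re (v / z) * Im (w / z) + Im (v / z) * Re (w / z))) +
           Im \<nu> * (g * (Im (v / z) * Im (w / z)) - G * (Re (v / z) * Im (w / z) + Im (v / z) * Re (w / z))
             + (p / a) * (a\<^sup>2 * (Re (v / z) * Re (w / z)) - G\<^sup>2 * (Im (v / z) * Im (w / z)))))"
      unfolding U_def by (rule quadratic_form_expand)
    also have "\<dots> = L * (Re (v / z) * Re (w / z)) +
     M * (Re (v / z) * Im (w / z) + Im (v / z) * Re (w / z)) + Q * (Im (v / z) * Im (w / z))"
    proof -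
      define e where "e = p / a"
      have e: "p * G\<^sup>2 / a = e * G\<^sup>2" "p = e * a"
        using a by (simp_all add: e_def)
      show ?thesis
        unfolding L_def M_def Q_def e_def[symmetric] e(1) unfolding e(2)
        by (simp add: power2_eq_square algebra_simps)
    qed
    finally show ?thesis .
  qed
  \<comment> \<open>Substituting \<open>n1\<close> and \<open>n2\<close> cancels every term in Re
    \<nu>, in \<open>L\<close> as well as in \<open>Q\<close>; only the common factor
    \<open>K * Im \<nu>\<close> is left.\<close>
  have L: "L = K * Im \<nu> * (p * (a - G))"
  proof -
    have "L = - (c * Re \<mu>) + p * (c * Im \<mu>) + K * (- a * Re \<nu> + a * p * Im \<nu>)"
      by (simp add: L_def algebra_simps)
    then show ?thesis unfolding n1 n2 by (simp add: algebra_simps)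
  qed
  have Q: "Q = K * Im \<nu> * (p * G + g - p * G\<^sup>2 / a)"
  proof -
    have "Q = (c * Re \<mu>) - p * (c * Im \<mu>) + K * (a * Re \<nu> + (g - p * G\<^sup>2 / a) * Im \<nu>)"
      by (simp add: Q_def algebra_simps)
    then show ?thesis unfolding n1 n2 by (simp add: algebra_simps)
  qed
  have GE: "c + K * G\<^sup>2 = (r / R) * (c + K * a\<^sup>2)"
    using pos a y by (simp add: G_def angular_def rR c_def K_def field_simps power2_eq_square)
  have "p * G + g - p * G\<^sup>2 / a + (r / R) * (p * (a - G)) = 0"
  proof -
    have eqs: "p * G = a * r * x * y * (R / (R\<^sup>2 * y\<^sup>2))"
      "g = a * r * x * y * (- 2 * (a\<^sup>2 - 1) * y\<^sup>2 / (R\<^sup>2 * y\<^sup>2))"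
      "p * G\<^sup>2 / a = a * r * x * y * (r / (R\<^sup>2 * y\<^sup>2))"
      "(r / R) * (p * (a - G)) = a * r * x * y * ((R - r) / (R\<^sup>2 * y\<^sup>2))"
      using pos a y
      by (simp_all add: G_def g_def angular_def angular'_def rR p_def divide_simps power2_eq_square
          flip: x_def y_def) (simp_all add: algebra_simps)
    have "t * (A / d) + t * (B / d) - t * (C / d) + t * (D / d) = t * ((A + B - C + D) / d)"
      for t A B C D d :: real
      by (simp add: add_divide_distrib diff_divide_distrib algebra_simps)
    then have "p * G + g - p * G\<^sup>2 / a + (r / R) * (p * (a - G)) =
      a * r * x * y * ((R + - 2 * (a\<^sup>2 - 1) * y\<^sup>2 - r + (R - r)) / (R\<^sup>2 * y\<^sup>2))"
      unfolding eqs .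
    also have "R + - 2 * (a\<^sup>2 - 1) * y\<^sup>2 - r + (R - r) = 0"
      by (simp add: R_def r_def algebra_simps)
    finally show ?thesis by simp
  qed
  moreover have "(c + K * a\<^sup>2) * Q + (c + K * G\<^sup>2) * L =
      (c + K * a\<^sup>2) * (K * Im \<nu>) * (p * G + g - p * G\<^sup>2 / a + (r / R) * (p * (a - G)))"
  proof -
    have "e * (k * X) + t * e * (k * Y) = e * k * (X + t * Y)" for e k X t Y :: real
      by (simp add: algebra_simps)
    then show ?thesis
      unfolding GE L Q .
  qed
  ultimately have "(c + K * a\<^sup>2) * Q + (c + K * G\<^sup>2) * L = 0"
    by simp
  from trace_numerator_eq_0[OF this, where \<alpha> = "\<lambda>v. Re (v / z)" and \<beta> = "\<lambda>v. Im (v / z)",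
      OF I II, of \<i> 1]
  show "mean_curvature (\<lambda>z. z) ?f z N = 0"
    unfolding mean_curvature_def by simp
qed

lemma minimal_lagrangian_stretch: "a > 0 \<Longrightarrow> minimal_lagrangian (stretch a 1 a)"
  by (simp add: minimal_lagrangian_def op_diffeo_stretch area_preserving_stretch
      minimal_surface_stretch)

theorem corollary4:
  shows "\<not> (\<exists>C::real. C > 0 \<and>
            (\<forall>(\<phi> :: real option \<Rightarrow> real option) (f :: complex \<Rightarrow> complex).
               quasisymmetric \<phi> \<and> minimal_lagrangian f \<and> extends_continuously f \<phi> \<longrightarrow>
               log_ereal (max_dilatation f) \<ge> ereal C * cr_norm \<phi>))"
proof
  assume "\<exists>C::real. C > 0 \<and>
            (\<forall>(\<phi> :: real option \<Rightarrow> real option) (f :: complex \<Rightarrow> complex).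
               quasisymmetric \<phi> \<and> minimal_lagrangian f \<and> extends_continuously f \<phi> \<longrightarrow>
               log_ereal (max_dilatation f) \<ge> ereal C * cr_norm \<phi>)"
  then obtain C :: real where C: "C > 0" and bound:
    "\<And>\<phi> f. \<lbrakk>quasisymmetric \<phi>; minimal_lagrangian f; extends_continuously f \<phi>\<rbrakk> \<Longrightarrow>
       ereal C * cr_norm \<phi> \<le> log_ereal (max_dilatation f)"
    by blast
  obtain n where n: "odd n" "2 * ln (real n) < C * ln (2 ^ n - 1)"
    using exists_odd_ln_less[OF C] by blast
  have n0: "n > 0" using n(1) by (rule odd_pos)
  let ?\<phi> = "map_option (\<lambda>x::real. x ^ n)" and ?f = "stretch (real n) 1 (real n)"
  have "ereal C * ereal (ln (2 ^ n - 1)) \<le> ereal C * cr_norm ?\<phi>"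
    using C n0 by (intro ereal_mult_left_mono cr_norm_power_ge) auto
  also have "\<dots> \<le> log_ereal (max_dilatation ?f)"
    using n0 by (intro bound quasisymmetric_power extends_continuously_stretch
        minimal_lagrangian_stretch n(1)) simp
  also have "\<dots> \<le> ereal (2 * ln (real n))"
    using n0 by (intro log_max_dilatation_stretch) simp
  finally show False
    using n(2) by simp
qed

end
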